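(* Let $n$ be a positive integer, $\lambda=(\lambda_1\ge\lambda_2\ge\cdots\ge\lambda_p)$ a partition with positive parts and $\lambda_1\le n$, and let $m\le\lambda_p$. Let $M\subseteq\{1,2,\dots,\lambda_p\}$ with $|M|=m$. Then, in $\mathbf{U}(gl(n))$, $$(-1)^{|\lambda|m}\left[\begin{array}{l}\mathbf{K}^\lambda\\ M\end{array}\right]=\sum_{k=0}^{m}(-1)^{m-k}(p)_{m-k}\sum_{J\subseteq M,\ |J|=k}[\underline{J}^*|\underline{J}]\ \mathbf{K}^\lambda ,$$ where $(p)_j=p(p-1)\cdots(p-j+1)$ is the falling factorial and $|\lambda|=\lambda_1+\cdots+\lambda_p$.
   Context: Capelli bitableaux. Let $\mathcal{A}_0=\{\alpha_1,\alpha_2,\dots\}$ be a sufficiently large finite set of virtual symbols, with $|\alpha_s|=0\in\mathbb{Z}_2$, let $m_0$ be its cardinality, and let $\mathcal{L}=\{1,\dots,n\}$ be the proper symbols, with $|i|=1\in\mathbb{Z}_2$. Let $gl(m_0|n)$ be the complex Lie superalgebra with basis $e_{a,b}$, $a,b\in\mathcal{A}_0\cup\mathcal{L}$, of parity $|a|+|b|$, and superbracket $[e_{a,b},e_{c,d}]=\delta_{bc}e_{a,d}-(-1)^{(|a|+|b|)(|c|+|d|)}\delta_{ad}e_{c,b}$. The enveloping algebra $\mathbf{U}(gl(n))$ is the subalgebra of $\mathbf{U}(gl(m_0|n))$ generated by the $e_{i,j}$, $i,j\in\mathcal{L}$. A product $e_{a_r,b_r}\cdots e_{a_1,b_1}$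 is irregular if there are $i\le r$ and $\gamma\in\mathcal{A}_0$ with $\#\{j\le i: b_j=\gamma\}>\#\{j<i: a_j=\gamma\}$. Let $\mathbf{Irr}$ be the left ideal of $\mathbf{U}(gl(m_0|n))$ generated by the irregular products. It is known that $\mathbf{U}(gl(n))\cap\mathbf{Irr}=0$, that $Virt=\mathbf{U}(gl(n))\oplus\mathbf{Irr}$ is a subalgebra, and that $\mathbf{Irr}$ is a two-sided ideal of it; the Capelli devirtualization epimorphism $\mathfrak{p}:Virt\to\mathbf{U}(gl(n))$ is the projection with kernel $\mathbf{Irr}$. For Young tableaux $S=(s_{ij})$, $T=(t_{ij})$ of the same shape $\nu=(\nu_1\ge\dots\ge\nu_q)$ with entries in $\mathcal{L}$, the Capelli bitableau is $$[S|T]=\mathfrak{p}\Big(\prod_{i=1}^{q}\big(e_{s_{i1},\alpha_i}e_{s_{i2},\alpha_i}\cdots e_{s_{i\nu_i},\alpha_i}\big)\cdot\prod_{i=1}^{q}\big(e_{\alpha_i,t_{i1}}e_{\alpha_i,t_{i2}}\cdots e_{\alpha_i,t_{i\nu_i}}\big)\Big),$$ with products ordered from left to right by increasing $i$ and $\alpha_1,\dots,\alpha_q$ distinct virtual symbols (the argument lies in $Virt$ and the result does not depend on the choice of the $\alpha_i$). Empty rows may be omitted, and the empty bitableau is $\mathbf{1}$. The Capelli-Deruyts bitableau $\mathbf{K}^\lambda$ is $[S|T]$ where the $i$-th row of $S$ is $\lambda_i\ \cdots\ 2\ 1$ and the $i$-th row of $T$ is $1\ 2\ \cdots\ \lambda_i$,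 $i=1,\dots,p$. For $J=\{j_1<\cdots<j_k\}$ write $\underline{J}=j_1j_2\cdots j_k$ and $\underline{J}^*=j_k\cdots j_2j_1$; $[\underline{J}^*|\underline{J}]$ is the one-row Capelli bitableau. For $J\subseteq\{1,\dots,\lambda_p\}$, $\left[\begin{array}{l}\mathbf{K}^\lambda\\ J\end{array}\right]$ denotes the Capelli bitableau obtained from $\mathbf{K}^\lambda$ by adding a last, $(p+1)$-th, row $\underline{J}^*$ to the left tableau and $\underline{J}$ to the right tableau. *)

theory Defs
  imports
    Complex_Main
    "HOL-Library.Poly_Mapping"
    "HOL-Algebra.QuotRing"
    "HOL-Algebra.Generated_Rings"
begin

text \<open>
  Lists form a monoid under concatenation, so that \<open>'a list \<Rightarrow>\<^sub>0 complex\<close>, with the convolution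
  product of \<^theory>\<open>HOL-Library.Poly_Mapping\<close>, is the free associative complex algebra on \<open>'a\<close>.
\<close>

instantiation list :: (type) monoid_add
begin

definition zero_list :: "'a list" where "zero_list = []"

definition plus_list :: "'a list \<Rightarrow> 'a list \<Rightarrow> 'a list" where "plus_list = (@)"

instance
  by standard (simp_all add: zero_list_def plus_list_def)

end


subsection \<open>The general linear Lie superalgebra and its enveloping algebra\<close>

text \<open>\<open>Virtual s\<close> is the symbol \<open>\<alpha>\<^sub>s\<close>; the indices of both kinds of symbols start at 1.\<close>

datatype symbol = Virtual nat | Proper nat

fun parity :: "symbol \<Rightarrow> nat" where
  "parity (Virtual s) = 0"
| "parity (Proper i) = 1"

definition virtuals :: "nat \<Rightarrow> symbol set" where
  "virtuals m0 = Virtual ` {1..m0}"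

definition propers :: "nat \<Rightarrow> symbol set" where
  "propers n = Proper ` {1..n}"

definition symbols :: "nat \<Rightarrow> nat \<Rightarrow> symbol set" where
  "symbols m0 n = virtuals m0 \<union> propers n"

type_synonym free_elt = "(symbol \<times> symbol) list \<Rightarrow>\<^sub>0 complex"

text \<open>The tensor algebra of \<open>gl(m0|n)\<close>: the free algebra on the basis \<open>e\<^bsub>a,b\<^esub>\<close>.\<close>

definition tensor_alg :: "nat \<Rightarrow> nat \<Rightarrow> free_elt ring" where
  "tensor_alg m0 n =
     \<lparr>carrier = {f. \<forall>w \<in> Poly_Mapping.keys f. set w \<subseteq> symbols m0 n \<times> symbols m0 n},
      mult = (*), one = 1, zero = 0, add = (+)\<rparr>"

lemma tensor_alg_ring: "ring (tensor_alg m0 n)"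
proof (rule ringI)
  show "abelian_group (tensor_alg m0 n)"
  proof (rule abelian_groupI)
    fix x assume "x \<in> carrier (tensor_alg m0 n)"
    then show "\<exists>y\<in>carrier (tensor_alg m0 n). y \<oplus>\<^bsub>tensor_alg m0 n\<^esub> x = \<zero>\<^bsub>tensor_alg m0 n\<^esub>"
      by (intro bexI[of _ "- x"]) (auto simp: tensor_alg_def keys_def)
  qed (auto simp: tensor_alg_def ac_simps dest!: subsetD[OF Poly_Mapping.keys_add])
  show "Group.monoid (tensor_alg m0 n)"
    by (rule monoidI, auto simp: tensor_alg_def mult.assoc plus_list_def zero_list_def
        dest!: subsetD[OF keys_mult]) fastforce+
qed (auto simp: tensor_alg_def algebra_simps)

definition E :: "symbol \<Rightarrow> symbol \<Rightarrow> free_elt" where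
  "E a b = Poly_Mapping.single [(a, b)] 1"

definition superbracket :: "symbol \<Rightarrow> symbol \<Rightarrow> symbol \<Rightarrow> symbol \<Rightarrow> free_elt" where
  "superbracket a b c d =
     (if b = c then E a d else 0)
     - (-1) ^ ((parity a + parity b) * (parity c + parity d)) * (if a = d then E c b else 0)"

definition env_relations :: "nat \<Rightarrow> nat \<Rightarrow> free_elt set" where
  "env_relations m0 n =
     {E a b * E c d - (-1) ^ ((parity a + parity b) * (parity c + parity d)) * (E c d * E a b)
        - superbracket a b c d
      | a b c d. {a, b, c, d} \<subseteq> symbols m0 n}"

definition env_ideal :: "nat \<Rightarrow> nat \<Rightarrow> free_elt set" where
  "env_ideal m0 n = Idl\<^bsub>tensor_alg m0 n\<^esub> (env_relations m0 n)"

text \<open>\<open>Ugl m0 n\<close> is \<open>\<^bold>U(gl(m0|n))\<close>.\<close>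

definition Ugl :: "nat \<Rightarrow> nat \<Rightarrow> free_elt set ring" where
  "Ugl m0 n = tensor_alg m0 n Quot env_ideal m0 n"

definition env_class :: "nat \<Rightarrow> nat \<Rightarrow> free_elt \<Rightarrow> free_elt set" where
  "env_class m0 n f = env_ideal m0 n +>\<^bsub>tensor_alg m0 n\<^esub> f"

definition gen :: "nat \<Rightarrow> nat \<Rightarrow> symbol \<times> symbol \<Rightarrow> free_elt set" where
  "gen m0 n = (\<lambda>(a, b). env_class m0 n (E a b))"

text \<open>The structure map \<open>\<complex> \<rightarrow> \<^bold>U(gl(m0|n))\<close>; scalar multiplication by \<open>c\<close> is multiplication
  by \<open>scalar m0 n c\<close>.\<close>

definition scalar :: "nat \<Rightarrow> nat \<Rightarrow> complex \<Rightarrow> free_elt set" where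
  "scalar m0 n c = env_class m0 n (Poly_Mapping.single [] c)"

definition gen_prod :: "nat \<Rightarrow> nat \<Rightarrow> (symbol \<times> symbol) list \<Rightarrow> free_elt set" where
  "gen_prod m0 n w = foldr (\<otimes>\<^bsub>Ugl m0 n\<^esub>) (map (gen m0 n) w) \<one>\<^bsub>Ugl m0 n\<^esub>"

text \<open>\<open>\<^bold>U(gl(n))\<close> as a subalgebra of \<open>\<^bold>U(gl(m0|n))\<close>; the scalars are put among the generators because
  \<^const>\<open>generate_ring\<close> generates subrings, not complex subalgebras.\<close>

definition Ugl_proper :: "nat \<Rightarrow> nat \<Rightarrow> free_elt set set" where
  "Ugl_proper m0 n =
     generate_ring (Ugl m0 n)
       (range (scalar m0 n) \<union> gen m0 n ` (propers n \<times> propers n))"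


subsection \<open>Devirtualization\<close>

text \<open>A list \<open>w = [(a\<^sub>r, b\<^sub>r), \<dots>, (a\<^sub>1, b\<^sub>1)]\<close> stands for the product
  \<open>e\<^bsub>a\<^sub>r,b\<^sub>r\<^esub> \<cdots> e\<^bsub>a\<^sub>1,b\<^sub>1\<^esub>\<close>, whose factors are numbered from right to left; hence the \<^const>\<open>rev\<close>.\<close>

definition irregular :: "nat \<Rightarrow> (symbol \<times> symbol) list \<Rightarrow> bool" where
  "irregular m0 w \<longleftrightarrow>
     (\<exists>i \<in> {1..length w}. \<exists>\<gamma> \<in> virtuals m0.
        count_list (map snd (take i (rev w))) \<gamma> > count_list (map fst (take (i - 1) (rev w))) \<gamma>)"

definition left_ideal :: "'a set \<Rightarrow> ('a, 'b) ring_scheme \<Rightarrow> bool" where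
  "left_ideal I R \<longleftrightarrow>
     additive_subgroup I R \<and> (\<forall>a \<in> I. \<forall>x \<in> carrier R. x \<otimes>\<^bsub>R\<^esub> a \<in> I)"

definition gen_left_ideal :: "('a, 'b) ring_scheme \<Rightarrow> 'a set \<Rightarrow> 'a set" where
  "gen_left_ideal R S = \<Inter>{I. left_ideal I R \<and> S \<subseteq> I}"

definition Irr :: "nat \<Rightarrow> nat \<Rightarrow> free_elt set set" where
  "Irr m0 n =
     gen_left_ideal (Ugl m0 n)
       {gen_prod m0 n w | w. set w \<subseteq> symbols m0 n \<times> symbols m0 n \<and> irregular m0 w}"

text \<open>The projection \<open>\<^bold>U(gl(n)) \<oplus> \<^bold>I\<^bold>r\<^bold>r \<rightarrow> \<^bold>U(gl(n))\<close> along \<open>\<^bold>I\<^bold>r\<^bold>r\<close>; its values outside of this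
  direct sum are irrelevant.\<close>

definition devirt :: "nat \<Rightarrow> nat \<Rightarrow> free_elt set \<Rightarrow> free_elt set" where
  "devirt m0 n x = (THE u. u \<in> Ugl_proper m0 n \<and> x \<ominus>\<^bsub>Ugl m0 n\<^esub> u \<in> Irr m0 n)"


subsection \<open>Capelli bitableaux\<close>

text \<open>Tableaux are lists of rows, and row number \<open>i\<close> (counted from 1) is polarized with
  the virtual symbol \<open>\<alpha>\<^sub>i\<close>; at least as many virtual symbols as rows have to be available.\<close>

definition left_word :: "nat list list \<Rightarrow> (symbol \<times> symbol) list" where
  "left_word S =
     concat (map2 (\<lambda>i row. map (\<lambda>s. (Proper s, Virtual i)) row) [1..<Suc (length S)] S)"

definition right_word :: "nat list list \<Rightarrow> (symbol \<times> symbol) list" where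
  "right_word T =
     concat (map2 (\<lambda>i row. map (\<lambda>t. (Virtual i, Proper t)) row) [1..<Suc (length T)] T)"

definition capelli_bitableau ::
    "nat \<Rightarrow> nat \<Rightarrow> nat list list \<Rightarrow> nat list list \<Rightarrow> free_elt set" where
  "capelli_bitableau m0 n S T = devirt m0 n (gen_prod m0 n (left_word S @ right_word T))"

definition deruyts_left :: "nat list \<Rightarrow> nat list list" where
  "deruyts_left lam = map (\<lambda>l. rev [1..<Suc l]) lam"

definition deruyts_right :: "nat list \<Rightarrow> nat list list" where
  "deruyts_right lam = map (\<lambda>l. [1..<Suc l]) lam"

definition capelli_deruyts :: "nat \<Rightarrow> nat \<Rightarrow> nat list \<Rightarrow> free_elt set" where
  "capelli_deruyts m0 n lam = capelli_bitableau m0 n (deruyts_left lam) (deruyts_right lam)"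

definition row_bitableau :: "nat \<Rightarrow> nat \<Rightarrow> nat set \<Rightarrow> free_elt set" where
  "row_bitableau m0 n J =
     capelli_bitableau m0 n [rev (sorted_list_of_set J)] [sorted_list_of_set J]"

definition capelli_deruyts_row :: "nat \<Rightarrow> nat \<Rightarrow> nat list \<Rightarrow> nat set \<Rightarrow> free_elt set" where
  "capelli_deruyts_row m0 n lam J =
     capelli_bitableau m0 n
       (deruyts_left lam @ [rev (sorted_list_of_set J)])
       (deruyts_right lam @ [sorted_list_of_set J])"

definition falling_factorial :: "nat \<Rightarrow> nat \<Rightarrow> complex" where
  "falling_factorial p j = (\<Prod>i<j. of_nat p - of_nat i)"

end

theory Submission
  imports Defs "HOL-Library.Multiset"
begin

text \<open>
  Write the argument of the devirtualization in the bitableau with the extra row \<open>M\<close> as \<open>C* X C P\<close>, where \<open>C* C\<close> is the argument for \<open>\<^bold>K\<^sup>\<lambda>\<close> and \<open>X\<close>, \<open>P\<close> are the factors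
  \<open>e\<^bsub>i,\<beta>\<^esub>\<close> and \<open>e\<^bsub>\<beta>,i\<^esub>\<close> (\<open>i \<in> M\<close>) of the new row, with its own virtual symbol \<open>\<beta>\<close>. The factors of \<open>C\<close> and
  of \<open>P\<close> are odd and anticommute, so \<open>C P\<close> is \<open>P C\<close> up to the sign \<open>(-1)\<^bsup>|\<lambda>|m\<^esup>\<close>. Modulo \<open>\<^bold>I\<^bold>r\<^bold>r\<close>, the
  product \<open>X P\<close> in front of \<open>C\<close> may be replaced by its devirtualization \<open>[M*|M]\<close>, which is a column
  determinant in the \<open>e\<^bsub>i,j\<^esub>\<close> with the diagonal shifts \<open>m-1, \<dots>, 1, 0\<close> (lemma \<open>row_col\<close>).

  Each of the \<open>p\<close> rows of \<open>C*\<close> is a product of anticommuting square-zero elements that contains a factor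
  for every index in \<open>M\<close>. Hence the bracket of \<open>e\<^bsub>i,j\<^esub>\<close> with such a row is \<open>\<delta>\<^bsub>i,j\<^esub>\<close> times the row: the
  term for \<open>i \<noteq> j\<close> repeats a factor (lemma \<open>pp_row\<close>). Moving \<open>[M*|M]\<close> to the left of \<open>C*\<close> therefore
  replaces every \<open>e\<^bsub>i,j\<^esub>\<close> by \<open>e\<^bsub>i,j\<^esub> - p \<delta>\<^bsub>i,j\<^esub>\<close>, that is, it lowers all diagonal shifts by \<open>p\<close>. What
  remains is an identity for shifted column determinants: lowering the shifts by one subtracts the sum of
  the principal minors with one row and column less (lemma \<open>pminor_shift\<close>). Iterating this \<open>p\<close> times
  gives the coefficients \<open>(-1)\<^bsup>m-k\<^esup> (p)\<^bsub>m-k\<^esub>\<close> (lemma \<open>pminor_neg_shift\<close>).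

  The computation determines the devirtualization only because \<open>\<^bold>U(gl(n)) \<inter> \<^bold>I\<^bold>r\<^bold>r = 0\<close>. For this, \<open>gl(m\<^sub>0|n)\<close> acts on
  the tensor powers of its natural module enlarged by one trivial vector. Irregular products kill the
  words without virtual letters, because they have to destroy a virtual letter before it was created
  (lemma \<open>act_Irr\<close>), whereas \<open>\<^bold>U(gl(n))\<close> acts faithfully on these words (lemma \<open>faithful\<close>).

  Calculations in the quotient \<open>\<^bold>U(gl(m\<^sub>0|n))\<close>, whose elements are cosets, are replaced by calculations
  in a type of class \<open>ring_1\<close>, the product of the rings \<open>\<^bold>U(gl(m\<^sub>0|n))\<close> over all \<open>m\<^sub>0\<close> and \<open>n\<close>. The
  algebra is done in the locale \<open>gl_algebra\<close>, in any such type with elements that satisfy the relations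
  of \<open>gl(m\<^sub>0|n)\<close>, modulo a left ideal that contains the irregular products.
\<close>

section \<open>Shifted column determinants\<close>

text \<open>
  \<open>expand f g [t\<^sub>0, \<dots>, t\<^sub>k\<^sub>-\<^sub>1] = \<Sum>\<^sub>i (-1)\<^sup>i g(T\<^sub>i) f(t\<^sub>i)\<close>, where \<open>T\<^sub>i\<close> is the list without \<open>t\<^sub>i\<close>: the Laplace
  expansion of a determinant along a row \<open>f\<close>, if \<open>g\<close> are the complementary minors. As the entries do not
  commute, it matters that the entry stands to the right of the minor. With \<open>f\<close> the indicator of a single
  \<open>u\<close>, it is the contraction of an alternating function by \<open>u\<close>.
\<close>

fun expand :: "('b \<Rightarrow> 'a::ring_1) \<Rightarrow> ('b list \<Rightarrow> 'a) \<Rightarrow> 'b list \<Rightarrow> 'a" where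
  "expand f g [] = 0"
| "expand f g (t # T) = g T * f t - expand f (\<lambda>U. g (t # U)) T"

abbreviation delta :: "'b \<Rightarrow> 'b \<Rightarrow> 'a::ring_1" where
  "delta s t \<equiv> of_bool (s = t)"

lemma expand_add: "expand f (\<lambda>U. g U + h U) T = expand f g T + expand f h T"
  by (induction T arbitrary: g h) (auto simp: algebra_simps)

lemma expand_uminus: "expand f (\<lambda>U. - g U) T = - expand f g T"
  by (induction T arbitrary: g) (auto simp: algebra_simps)

lemma expand_diff: "expand f (\<lambda>U. g U - h U) T = expand f g T - expand f h T"
  using expand_add[of f g "\<lambda>U. - h U" T] by (simp add: expand_uminus)

lemma expand_zero [simp]: "expand f (\<lambda>U. 0) T = 0"
  by (induction T) auto

lemma expand_sum: "expand f (\<lambda>U. \<Sum>u\<in>B. g u U) T = (\<Sum>u\<in>B. expand f (g u) T)"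
  by (induction B rule: infinite_finite_induct) (auto simp: expand_add)

lemma expand_mult_left: "expand f (\<lambda>U. y * g U) T = y * expand f g T"
  by (induction T arbitrary: g) (auto simp: algebra_simps)

lemma expand_mult_right:
  assumes "\<And>t. t \<in> set T \<Longrightarrow> y * f t = h t * y"
  shows "expand f (\<lambda>U. g U * y) T = expand h g T * y"
  using assms by (induction T arbitrary: g) (auto simp: algebra_simps mult.assoc)

lemma expand_weight_add: "expand (\<lambda>t. f t + h t) g T = expand f g T + expand h g T"
  by (induction T arbitrary: g) (auto simp: algebra_simps)

lemma expand_weight_cong: "(\<And>t. t \<in> set T \<Longrightarrow> f t = h t) \<Longrightarrow> expand f g T = expand h g T"
  by (induction T arbitrary: g) auto

lemma expand_cong:
  assumes "\<And>U. Suc (length U) = length T \<Longrightarrow> set U \<subseteq> set T \<Longrightarrow> g U = h U"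
  shows "expand f g T = expand f h T"
  using assms
proof (induction T arbitrary: g h)
  case (Cons t T)
  have "expand f (\<lambda>U. g (t # U)) T = expand f (\<lambda>U. h (t # U)) T"
  proof (rule Cons.IH)
    fix U assume "Suc (length U) = length T" "set U \<subseteq> set T"
    then show "g (t # U) = h (t # U)" by (intro Cons.prems) auto
  qed
  moreover have "g T = h T" by (rule Cons.prems) auto
  ultimately show ?case by simp
qed auto

text \<open>
  Two columns are chosen one after the other; exchanging the order of the two choices changes the sign.
\<close>

lemma expand_expand:
  assumes "\<And>s t. f s * h t = h t * f s"
  shows "expand f (expand h g) T = - expand h (expand f g) T"
proof (induction T arbitrary: g)
  case (Cons t T)
  have "expand f (\<lambda>U. expand h g (t # U)) T
      = expand f (\<lambda>U. g U * h t) T - expand f (expand h (\<lambda>U. g (t # U))) T"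
    by (simp add: expand_diff)
  moreover have "expand h (\<lambda>U. expand f g (t # U)) T
      = expand h (\<lambda>U. g U * f t) T - expand h (expand f (\<lambda>U. g (t # U))) T"
    by (simp add: expand_diff)
  moreover have "expand f (\<lambda>U. g U * h t) T = expand f g T * h t"
    by (rule expand_mult_right) (simp add: assms)
  moreover have "expand h (\<lambda>U. g U * f t) T = expand h g T * f t"
    by (rule expand_mult_right) (simp add: assms)
  ultimately show ?case using Cons.IH[of "\<lambda>U. g (t # U)"] by (simp add: algebra_simps)
qed auto

lemma expand_swap:
  assumes "\<And>s t. f s * h t = h t * f s"
  shows "expand f (\<lambda>V. expand h (g V) T) S = expand h (\<lambda>W. expand f (\<lambda>V. g V W) S) T"
proof (induction S arbitrary: g)
  case (Cons s S)
  have "expand h (g S) T * f s = expand h (\<lambda>W. g S W * f s) T"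
    by (rule expand_mult_right[symmetric]) (simp add: assms)
  then show ?case by (simp add: Cons.IH expand_diff)
qed auto

lemma expand_delta_notin: "u \<notin> set T \<Longrightarrow> expand (delta u) g T = 0"
  by (induction T arbitrary: g) auto

lemma expand_delta_split:
  "u \<notin> set T1 \<Longrightarrow> u \<notin> set T2 \<Longrightarrow> expand (delta u) g (T1 @ u # T2) = (-1) ^ length T1 * g (T1 @ T2)"
  by (induction T1 arbitrary: g) (auto simp: expand_delta_notin)

text \<open>
  Removing the same entry from two copies of a list produces the same sign twice.
\<close>

lemma expand_delta_delta_distinct:
  assumes "distinct T" "u \<in> set T"
  shows "expand (delta u) (\<lambda>V. expand (delta u) (g V) T) T = g (remove1 u T) (remove1 u T)"
proof -
  obtain T1 T2 where T: "T = T1 @ u # T2" using assms(2) by (meson split_list)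
  with assms have "u \<notin> set T1" "u \<notin> set T2" by auto
  then show ?thesis
    by (simp add: T expand_delta_split remove1_append power_add[symmetric] mult.assoc[symmetric]
          flip: mult_2)
qed

text \<open>
  For lists \<open>S\<close> and \<open>T\<close> of length \<open>k\<close>, the column determinant
  \<open>\<Sum>\<^sub>\<sigma> sgn(\<sigma>) y\<^sub>k \<cdots> y\<^sub>2 y\<^sub>1\<close> with \<open>y\<^sub>l = x\<close> at \<open>(S\<^sub>l, T\<^bsub>\<sigma>(l)\<^esub>)\<close>, where \<open>c + k - l\<close> is added if the two
  indices are equal. The first row contributes the rightmost factor, since it stands for the
  operator that is applied first.
\<close>

primrec cminor :: "('b \<Rightarrow> 'b \<Rightarrow> 'a::ring_1) \<Rightarrow> int \<Rightarrow> 'b list \<Rightarrow> 'b list \<Rightarrow> 'a" where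
  "cminor x c [] = (\<lambda>T. of_bool (T = []))"
| "cminor x c (s # S) = (\<lambda>T. expand (\<lambda>t. x s t + delta s t * of_int (c + int (length T) - 1)) (cminor x c S) T)"

text \<open>
  Raising the shift by one adds the contraction by \<open>s\<close> to the expansion along a row \<open>s\<close>. Telescoping over the
  rows gives one correction term per row, in which one contraction stands among expansions. The contraction
  anticommutes with the expansions, at the price of raising their shift by one because they then act
  on lists that are shorter by one; so it can be moved to the outside. Summing over \<open>u\<close>, the double expansion
  pairs the removal of a row \<open>u\<close> with the removal of a column \<open>u\<close>.
\<close>

lemma cminor_shift_step:
  fixes x :: "'b \<Rightarrow> 'b \<Rightarrow> 'a::ring_1"
  assumes "finite B" "set S \<subseteq> B"
  shows "cminor x (c + 1) S T = cminor x c S T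
     + (\<Sum>u\<in>B. expand (delta u) (\<lambda>V. expand (delta u) (cminor x (c + 1) V) T) S)"
  using assms(2)
proof (induction S arbitrary: T)
  case (Cons s S)
  define f :: "'b \<Rightarrow> 'a" where "f = (\<lambda>t. x s t + delta s t * of_int (c + int (length T) - 1))"
  define D where "D = (\<lambda>W. \<Sum>u\<in>B. expand (delta u) (\<lambda>V. expand (delta u) (cminor x (c + 1) V) W) S)"
  have IH: "cminor x (c + 1) S = (\<lambda>W. cminor x c S W + D W)"
    using Cons by (auto simp: D_def)
  have "cminor x (c + 1) (s # S) T = expand (\<lambda>t. f t + delta s t) (cminor x (c + 1) S) T"
    by (auto simp: f_def algebra_simps intro!: expand_weight_cong)
  also have "\<dots> = expand (delta s) (cminor x (c + 1) S) T + expand f (cminor x c S) T + expand f D T"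
    by (simp only: expand_weight_add) (simp add: IH expand_add)
  also have "expand f (cminor x c S) T = cminor x c (s # S) T"
    by (simp add: f_def)
  also have "expand f D T = (\<Sum>u\<in>B. - expand (delta u) (\<lambda>V. expand (delta u) (cminor x (c + 1) (s # V)) T) S)"
    unfolding D_def expand_sum
  proof (rule sum.cong[OF refl])
    fix u
    have *: "expand f (expand (delta u) (cminor x (c + 1) V)) T = - expand (delta u) (cminor x (c + 1) (s # V)) T" for V
    proof -
      have "expand f (expand (delta u) (cminor x (c + 1) V)) T
          = - expand (delta u) (expand f (cminor x (c + 1) V)) T"
        by (rule expand_expand) simp
      also have "expand (delta u) (expand f (cminor x (c + 1) V)) T = expand (delta u) (cminor x (c + 1) (s # V)) T"
      proof (rule expand_cong)
        fix U :: "'b list" assume "Suc (length U) = length T"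
        then have "int (length T) = int (length U) + 1" by simp
        then show "expand f (cminor x (c + 1) V) U = cminor x (c + 1) (s # V) U"
          by (simp add: f_def algebra_simps)
      qed
      finally show ?thesis .
    qed
    have "expand f (\<lambda>W. expand (delta u) (\<lambda>V. expand (delta u) (cminor x (c + 1) V) W) S) T
        = expand (delta u) (\<lambda>V. expand f (\<lambda>W. expand (delta u) (cminor x (c + 1) V) W) T) S"
      by (rule expand_swap[symmetric]) simp
    then show "expand f (\<lambda>W. expand (delta u) (\<lambda>V. expand (delta u) (cminor x (c + 1) V) W) S) T =
         - expand (delta u) (\<lambda>V. expand (delta u) (cminor x (c + 1) (s # V)) T) S"
      by (simp add: * expand_uminus)
  qed
  also have "expand (delta s) (cminor x (c + 1) S) T
      = (\<Sum>u\<in>B. expand (delta u) (cminor x (c + 1) S) T * delta u s)"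
    using Cons.prems assms(1) by (simp add: of_bool_def if_distrib cong: if_cong)
  finally show ?case by (simp add: sum_subtractf sum_negf)
qed (simp)

definition pminor :: "(nat \<Rightarrow> nat \<Rightarrow> 'a::ring_1) \<Rightarrow> int \<Rightarrow> nat set \<Rightarrow> 'a" where
  "pminor x c M = cminor x c (sorted_list_of_set M) (sorted_list_of_set M)"

lemma pminor_shift:
  assumes "finite M"
  shows "pminor x c M = pminor x (c + 1) M - (\<Sum>u\<in>M. pminor x (c + 1) (M - {u}))"
proof -
  let ?T = "sorted_list_of_set M"
  have "(\<Sum>u\<in>M. expand (delta u) (\<lambda>V. expand (delta u) (cminor x (c + 1) V) ?T) ?T)
      = (\<Sum>u\<in>M. pminor x (c + 1) (M - {u}))"
    using assms by (intro sum.cong refl) (auto simp: pminor_def expand_delta_delta_distinct sorted_list_of_set_remove)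
  then show ?thesis
    using cminor_shift_step[of M ?T x c ?T] assms by (simp add: pminor_def)
qed

text \<open>
  The falling factorial as an integer, so that it makes sense in every ring.
\<close>

definition ffact :: "nat \<Rightarrow> nat \<Rightarrow> int" where
  "ffact p j = (\<Prod>i<j. int p - int i)"

lemma ffact_Suc_left: "ffact (Suc p) (Suc j) = (int p + 1) * ffact p j"
  by (simp add: ffact_def prod.lessThan_Suc_shift del: prod.lessThan_Suc)

lemma ffact_step: "ffact (Suc p) j = ffact p j + int j * ffact p (j - 1)"
proof (cases j)
  case (Suc i)
  have "ffact p (Suc i) = ffact p i * (int p - int i)" by (simp add: ffact_def)
  then show ?thesis by (simp add: Suc ffact_Suc_left algebra_simps)
qed (simp add: ffact_def)

lemma ffact_0_left: "ffact 0 j = of_bool (j = 0)"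
  by (cases j) (auto simp: ffact_def prod.lessThan_Suc_shift simp del: prod.lessThan_Suc)

text \<open>
  Induction on \<open>p\<close> with \<open>pminor_shift\<close>. A subset \<open>J\<close> of \<open>M\<close> with \<open>d\<close> elements less is obtained by first
  deleting any of these \<open>d\<close> elements, whence the recursion
  \<open>(p + 1)\<^sub>d = (p)\<^sub>d + d (p)\<^sub>d\<^sub>-\<^sub>1\<close> of the falling factorial.
\<close>

lemma pminor_neg_shift:
  assumes "finite M"
  shows "pminor x (- int p) M
    = (\<Sum>J\<in>Pow M. of_int ((-1) ^ (card M - card J) * ffact p (card M - card J)) * pminor x 0 J)"
  using assms
proof (induction p arbitrary: M)
  case 0
  have "(\<Sum>J\<in>Pow M. of_int ((-1) ^ (card M - card J) * ffact 0 (card M - card J)) * pminor x 0 J)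
     = (\<Sum>J\<in>{M}. pminor x 0 J)"
  proof (rule sum.mono_neutral_cong_right)
    show "\<forall>J\<in>Pow M - {M}. of_int ((-1) ^ (card M - card J) * ffact 0 (card M - card J)) * pminor x 0 J = 0"
    proof
      fix J assume "J \<in> Pow M - {M}"
      then have "card J < card M" using 0 by (auto intro: psubset_card_mono)
      then show "of_int ((-1) ^ (card M - card J) * ffact 0 (card M - card J)) * pminor x 0 J = 0"
        by (simp add: ffact_0_left)
    qed
  qed (use 0 in \<open>auto simp: ffact_0_left\<close>)
  then show ?case by simp
next
  case (Suc p)
  define co where "co p d = (of_int ((-1) ^ d * ffact p d) :: 'a)" for p d
  have "(\<Sum>u\<in>M. pminor x (- int p) (M - {u}))
      = (\<Sum>u\<in>M. \<Sum>J\<in>Pow (M - {u}). co p (card M - 1 - card J) * pminor x 0 J)"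
    using Suc by (intro sum.cong refl) (simp add: co_def)
  also have "\<dots> = (\<Sum>u\<in>M. \<Sum>J\<in>{J. J \<in> Pow M \<and> u \<notin> J}. co p (card M - 1 - card J) * pminor x 0 J)"
    by (intro sum.cong refl) auto
  also have "\<dots> = (\<Sum>J\<in>Pow M. \<Sum>u\<in>{u. u \<in> M \<and> u \<notin> J}. co p (card M - 1 - card J) * pminor x 0 J)"
    using Suc.prems by (intro sum.swap_restrict) auto
  also have "\<dots> = (\<Sum>J\<in>Pow M. of_nat (card M - card J) * co p (card M - card J - 1) * pminor x 0 J)"
  proof (rule sum.cong[OF refl])
    fix J assume "J \<in> Pow M"
    then have "card {u. u \<in> M \<and> u \<notin> J} = card M - card J"
      using Suc.prems by (simp add: card_Diff_subset finite_subset flip: set_diff_eq)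
    moreover have "card M - 1 - card J = card M - card J - 1" by simp
    ultimately show "(\<Sum>u\<in>{u. u \<in> M \<and> u \<notin> J}. co p (card M - 1 - card J) * pminor x 0 J)
        = of_nat (card M - card J) * co p (card M - card J - 1) * pminor x 0 J"
      by (simp add: mult.assoc)
  qed
  finally have sub: "(\<Sum>u\<in>M. pminor x (- int p) (M - {u}))
      = (\<Sum>J\<in>Pow M. of_nat (card M - card J) * co p (card M - card J - 1) * pminor x 0 J)" .
  have co_step: "co (Suc p) d = co p d - of_nat d * co p (d - 1)" for d
  proof -
    have "(-1) ^ d * ffact (Suc p) d = (-1) ^ d * ffact p d - int d * ((-1) ^ (d - 1) * ffact p (d - 1))"
      by (cases d) (simp_all add: ffact_step algebra_simps)
    then have "co (Suc p) d = of_int ((-1) ^ d * ffact p d - int d * ((-1) ^ (d - 1) * ffact p (d - 1)))"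
      by (simp only: co_def)
    then show ?thesis by (simp add: co_def)
  qed
  have "pminor x (- int (Suc p)) M = pminor x (- int p) M - (\<Sum>u\<in>M. pminor x (- int p) (M - {u}))"
    using pminor_shift[OF Suc.prems, of x "- int (Suc p)"] by simp
  also have "\<dots> = (\<Sum>J\<in>Pow M. co (Suc p) (card M - card J) * pminor x 0 J)"
    unfolding sub Suc.IH[OF Suc.prems] co_step by (simp add: co_def left_diff_distrib sum_subtractf)
  finally show ?case by (simp add: co_def)
qed

section \<open>Words of tableaux\<close>

text \<open>
  A pair \<open>(i, t)\<close> is the occurrence of the entry \<open>t\<close> in row number \<open>i\<close>, the row polarized with the virtual
  symbol number \<open>i\<close>. The left and the right word of a tableau arise from the same list of pairs.
\<close>

definition cells :: "nat list list \<Rightarrow> (nat \<times> nat) list" where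
  "cells T = concat (map2 (\<lambda>i row. map (Pair i) row) [1..<Suc (length T)] T)"

lemma right_word_cells: "right_word T = map (\<lambda>(i, t). (Virtual i, Proper t)) (cells T)"
  by (auto simp: right_word_def cells_def map_concat comp_def split_def intro!: arg_cong[where f = concat])

lemma left_word_cells: "left_word S = map (\<lambda>(i, s). (Proper s, Virtual i)) (cells S)"
  by (auto simp: left_word_def cells_def map_concat comp_def split_def intro!: arg_cong[where f = concat])

lemma cells_Nil [simp]: "cells [] = []"
  by (simp add: cells_def)

lemma cells_snoc: "cells (T @ [r]) = cells T @ map (Pair (Suc (length T))) r"
  by (simp add: cells_def upt_Suc_append del: upt_Suc)

lemma cells_bounds: "(i, t) \<in> set (cells T) \<Longrightarrow> i \<in> {1..length T} \<and> (\<exists>r\<in>set T. t \<in> set r)"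
  by (induction T rule: rev_induct) (auto simp: cells_snoc)

lemma length_cells: "length (cells T) = sum_list (map length T)"
  by (induction T rule: rev_induct) (auto simp: cells_snoc)

lemma prod_list_anticommute:
  fixes xs ys :: "'a::ring_1 list"
  assumes "\<And>x y. x \<in> set xs \<Longrightarrow> y \<in> set ys \<Longrightarrow> x * y = - (y * x)"
  shows "prod_list xs * prod_list ys = (-1) ^ (length xs * length ys) * (prod_list ys * prod_list xs)"
proof -
  have one: "x * prod_list ys = (-1) ^ length ys * (prod_list ys * x)"
    if "\<And>y. y \<in> set ys \<Longrightarrow> x * y = - (y * x)" for x :: 'a and ys
    using that
  proof (induction ys)
    case (Cons y ys)
    have "x * prod_list (y # ys) = - (y * (x * prod_list ys))"
      using Cons.prems[of y] by (simp flip: mult.assoc)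
    also have "x * prod_list ys = (-1) ^ length ys * (prod_list ys * x)"
      using Cons by simp
    also have "y * ((-1) ^ length ys * (prod_list ys * x)) = (-1) ^ length ys * (y * prod_list ys * x)"
      by (cases "even (length ys)") (simp_all add: mult.assoc)
    finally show ?case by (simp add: mult.assoc)
  qed simp
  show ?thesis
    using assms
  proof (induction xs)
    case (Cons x xs)
    have "prod_list (x # xs) * prod_list ys
        = (-1) ^ (length xs * length ys) * (x * prod_list ys * prod_list xs)"
      using Cons by (cases "even (length xs * length ys)") (simp_all add: mult.assoc)
    also have "x * prod_list ys = (-1) ^ length ys * (prod_list ys * x)"
      using Cons by (intro one) simp
    finally show ?case
      by (cases "even (length ys)"; cases "even (length xs * length ys)") (simp_all add: mult.assoc)
  qed simp
qed

section \<open>Calculations modulo irregular products\<close>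

text \<open>
  An abstract stand-in for \<open>\<^bold>U(gl(m\<^sub>0|n))\<close> with the left ideal \<open>\<^bold>I\<^bold>r\<^bold>r\<close> in the role of \<open>Z\<close>; the set \<open>K\<close> plays
  the role of the scalars. The assumption \<open>double_zero\<close> turns \<open>x\<^sup>2 = - x\<^sup>2\<close>, which the relations
  give for an odd generator \<open>x\<close>, into \<open>x\<^sup>2 = 0\<close>.
\<close>

locale gl_algebra =
  fixes m0 n :: nat
    and e :: "symbol \<Rightarrow> symbol \<Rightarrow> 'a::ring_1"
    and K Z :: "'a set"
  assumes relation: "\<And>a b c d. {a, b, c, d} \<subseteq> symbols m0 n \<Longrightarrow>
      e a b * e c d = (-1) ^ ((parity a + parity b) * (parity c + parity d)) * (e c d * e a b)
        + ((if b = c then e a d else 0)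
           - (-1) ^ ((parity a + parity b) * (parity c + parity d)) * (if a = d then e c b else 0))"
    and double_zero: "\<And>x. x + x = 0 \<Longrightarrow> x = (0::'a)"
    and central: "\<And>k x. k \<in> K \<Longrightarrow> k * x = x * k"
    and Z_zero: "0 \<in> Z"
    and Z_add: "\<And>x y. x \<in> Z \<Longrightarrow> y \<in> Z \<Longrightarrow> x + y \<in> Z"
    and Z_mult: "\<And>x y. y \<in> Z \<Longrightarrow> x * y \<in> Z"
    and Z_irregular: "\<And>w. set w \<subseteq> symbols m0 n \<times> symbols m0 n \<Longrightarrow> irregular m0 w \<Longrightarrow>
      prod_list (map (case_prod e) w) \<in> Z"
begin

text \<open>
  The two letters tell which of the two symbols are proper and which are virtual. Read as operators, \<open>vp\<close>
  creates a virtual symbol and \<open>pv\<close> destroys one.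
\<close>

abbreviation "pp i j \<equiv> e (Proper i) (Proper j)"
abbreviation "pv i s \<equiv> e (Proper i) (Virtual s)"
abbreviation "vp s i \<equiv> e (Virtual s) (Proper i)"
abbreviation "vv s t \<equiv> e (Virtual s) (Virtual t)"

lemma symbols_iff [simp]:
  "Proper i \<in> symbols m0 n \<longleftrightarrow> i \<in> {1..n}"
  "Virtual s \<in> symbols m0 n \<longleftrightarrow> s \<in> {1..m0}"
  by (auto simp: symbols_def virtuals_def propers_def)

lemma pp_vp:
  "\<lbrakk>i \<in> {1..n}; j \<in> {1..n}; k \<in> {1..n}; s \<in> {1..m0}\<rbrakk> \<Longrightarrow>
    pp i j * vp s k = vp s k * pp i j - delta i k * vp s j"
  using relation[of "Proper i" "Proper j" "Virtual s" "Proper k"] by auto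

lemma pp_pv:
  "\<lbrakk>i \<in> {1..n}; j \<in> {1..n}; k \<in> {1..n}; s \<in> {1..m0}\<rbrakk> \<Longrightarrow>
    pp i j * pv k s = pv k s * pp i j + delta j k * pv i s"
  using relation[of "Proper i" "Proper j" "Proper k" "Virtual s"] by auto

lemma vv_vp:
  "\<lbrakk>s \<in> {1..m0}; t \<in> {1..m0}; r \<in> {1..m0}; k \<in> {1..n}\<rbrakk> \<Longrightarrow>
    vv s t * vp r k = vp r k * vv s t + delta t r * vp s k"
  using relation[of "Virtual s" "Virtual t" "Virtual r" "Proper k"] by auto

lemma pv_vp:
  "\<lbrakk>i \<in> {1..n}; j \<in> {1..n}; s \<in> {1..m0}; t \<in> {1..m0}\<rbrakk> \<Longrightarrow>
    pv i s * vp t j = delta s t * pp i j + delta i j * vv t s - vp t j * pv i s"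
  using relation[of "Proper i" "Virtual s" "Virtual t" "Proper j"] by auto

lemma vp_vp:
  "\<lbrakk>i \<in> {1..n}; j \<in> {1..n}; s \<in> {1..m0}; t \<in> {1..m0}\<rbrakk> \<Longrightarrow>
    vp s i * vp t j = - (vp t j * vp s i)"
  using relation[of "Virtual s" "Proper i" "Virtual t" "Proper j"] by auto

lemma pv_pv:
  "\<lbrakk>i \<in> {1..n}; j \<in> {1..n}; s \<in> {1..m0}; t \<in> {1..m0}\<rbrakk> \<Longrightarrow>
    pv i s * pv j t = - (pv j t * pv i s)"
  using relation[of "Proper i" "Virtual s" "Proper j" "Virtual t"] by auto

text \<open>
  Moving a proper generator to the left over an annihilator of \<open>s\<close> only produces annihilators of \<open>s\<close>. This
  is what makes the left ideal of irregular products stable under right multiplication by \<open>\<^bold>U(gl(n))\<close>.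
\<close>

lemma virtual_pp:
  assumes "a \<in> symbols m0 n" "s \<in> {1..m0}" "i \<in> {1..n}" "j \<in> {1..n}"
  shows "e a (Virtual s) * pp i j = pp i j * e a (Virtual s) - (if a = Proper j then pv i s else 0)"
  using assms relation[of a "Virtual s" "Proper i" "Proper j"] by (auto)

lemma Z_uminus: "x \<in> Z \<Longrightarrow> - x \<in> Z"
  using Z_mult[of x "-1"] by simp

lemma Z_diff: "x \<in> Z \<Longrightarrow> y \<in> Z \<Longrightarrow> x - y \<in> Z"
  using Z_add[of x "- y"] Z_uminus by simp

text \<open>
  The counterpart of \<open>\<^bold>U(gl(n))\<close>.
\<close>

inductive_set proper_alg :: "'a set" where
  proper_alg_one: "1 \<in> proper_alg"
| proper_alg_central: "k \<in> K \<Longrightarrow> k \<in> proper_alg"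
| proper_alg_gen: "i \<in> {1..n} \<Longrightarrow> j \<in> {1..n} \<Longrightarrow> pp i j \<in> proper_alg"
| proper_alg_uminus: "x \<in> proper_alg \<Longrightarrow> - x \<in> proper_alg"
| proper_alg_add: "x \<in> proper_alg \<Longrightarrow> y \<in> proper_alg \<Longrightarrow> x + y \<in> proper_alg"
| proper_alg_mult: "x \<in> proper_alg \<Longrightarrow> y \<in> proper_alg \<Longrightarrow> x * y \<in> proper_alg"

lemma proper_alg_zero: "0 \<in> proper_alg"
  using proper_alg_add[OF proper_alg_one proper_alg_uminus[OF proper_alg_one]] by simp

lemma proper_alg_diff: "x \<in> proper_alg \<Longrightarrow> y \<in> proper_alg \<Longrightarrow> x - y \<in> proper_alg"
  using proper_alg_add[OF _ proper_alg_uminus[of y], of x] by simp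

lemma proper_alg_of_nat: "of_nat k \<in> proper_alg"
  by (induction k) (auto intro: proper_alg_zero proper_alg_one proper_alg_add)

lemma proper_alg_of_int: "of_int k \<in> proper_alg"
  by (cases k rule: int_cases2) (auto intro: proper_alg_of_nat proper_alg_uminus)

definition creation_word :: "(nat \<times> nat) list \<Rightarrow> 'a" where
  "creation_word ys = prod_list (map (\<lambda>(s, t). vp s t) ys)"

definition annihilation_word :: "(nat \<times> nat) list \<Rightarrow> 'a" where
  "annihilation_word xs = prod_list (map (\<lambda>(s, i). pv i s) xs)"

lemma creation_word_simps [simp]: "creation_word [] = 1" "creation_word (p # ys) = vp (fst p) (snd p) * creation_word ys" "creation_word (xs @ ys) = creation_word xs * creation_word ys"
  by (simp_all add: creation_word_def split_def)

lemma annihilation_word_simps [simp]: "annihilation_word [] = 1" "annihilation_word (p # ys) = pv (snd p) (fst p) * annihilation_word ys" "annihilation_word (xs @ ys) = annihilation_word xs * annihilation_word ys"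
  by (simp_all add: annihilation_word_def split_def)

text \<open>
  Without \<open>g\<close>, the product is irregular because no factor to the right of \<open>e a (Virtual s)\<close> creates the
  symbol \<open>s\<close>. The elements \<open>g\<close> for which the claim holds for all \<open>a\<close> are stable under left multiplication
  by the generators of \<open>\<^bold>U(gl(n))\<close>, by lemma \<open>virtual_pp\<close>.
\<close>

lemma annihilator_in_Z:
  assumes "g \<in> proper_alg" "a \<in> symbols m0 n" "s \<in> {1..m0}" "set ys \<subseteq> {1..m0} \<times> {1..n}" "s \<notin> fst ` set ys"
  shows "e a (Virtual s) * g * creation_word ys \<in> Z"
proof -
  define X where "X = {g. \<forall>a\<in>symbols m0 n. e a (Virtual s) * g * creation_word ys \<in> Z}"
  have X_add: "x + y \<in> X" if "x \<in> X" "y \<in> X" for x y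
    using that Z_add by (auto simp: X_def algebra_simps)
  have X_uminus: "- x \<in> X" if "x \<in> X" for x
    using that Z_uminus by (auto simp: X_def)
  have "1 \<in> X"
    unfolding X_def
  proof safe
    fix a assume a: "a \<in> symbols m0 n"
    define w where "w = (a, Virtual s) # map (\<lambda>(s, t). (Virtual s, Proper t)) ys"
    let ?f = "\<lambda>(s, t). (Virtual s, Proper t)"
    have 1: "count_list (map (snd \<circ> ?f) (rev ys)) (Virtual s) = 0"
      and 2: "count_list (map (fst \<circ> ?f) (rev ys)) (Virtual s) = 0"
      using assms(5) by (force simp: count_list_0_iff)+
    have "count_list (map snd (take (length w) (rev w))) (Virtual s) = 1"
      using 1 by (simp add: w_def rev_map)
    moreover have "count_list (map fst (take (length w - 1) (rev w))) (Virtual s) = 0"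
      using 2 by (simp add: w_def rev_map)
    ultimately have "irregular m0 w"
      unfolding irregular_def using assms(3)
      by (intro bexI[of _ "length w"] bexI[of _ "Virtual s"]) (auto simp: w_def virtuals_def)
    moreover have "set w \<subseteq> symbols m0 n \<times> symbols m0 n"
      using assms a by (auto simp: w_def)
    ultimately have "prod_list (map (case_prod e) w) \<in> Z" by (rule Z_irregular[rotated])
    then show "e a (Virtual s) * 1 * creation_word ys \<in> Z"
      by (simp add: w_def creation_word_def comp_def split_def)
  qed
  have "\<forall>h\<in>X. g * h \<in> X" using assms(1)
  proof induction
    case (proper_alg_central k)
    have "e a (Virtual s) * (k * h) * creation_word ys = k * (e a (Virtual s) * h * creation_word ys)" for a h
      using central[OF proper_alg_central, of "e a (Virtual s)"] by (metis mult.assoc)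
    then show ?case using Z_mult[of _ k] by (simp add: X_def)
  next
    case (proper_alg_gen i j)
    have "e a (Virtual s) * (pp i j * h) * creation_word ys \<in> Z" if h: "h \<in> X" and a: "a \<in> symbols m0 n" for h a
    proof -
      have "e a (Virtual s) * (pp i j * h) * creation_word ys
         = pp i j * (e a (Virtual s) * h * creation_word ys) - (if a = Proper j then pv i s * h * creation_word ys else 0)"
        unfolding mult.assoc[symmetric] virtual_pp[OF a assms(3) proper_alg_gen]
        by (simp add: left_diff_distrib mult.assoc)
      moreover have "pv i s * h * creation_word ys \<in> Z" using h proper_alg_gen by (auto simp: X_def)
      moreover have "e a (Virtual s) * h * creation_word ys \<in> Z" using h a by (auto simp: X_def)
      ultimately show ?thesis by (auto intro: Z_diff Z_mult)
    qed
    then show ?case by (auto simp: X_def)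
  next
    case (proper_alg_mult x y)
    then show ?case by (simp add: mult.assoc)
  next
    case (proper_alg_add x y)
    then show ?case by (simp add: distrib_right X_add)
  qed (simp_all add: X_uminus)
  then have "g * 1 \<in> X" using \<open>1 \<in> X\<close> by blast
  then show ?thesis using assms(2) by (simp add: X_def)
qed

subsection \<open>One-row bitableaux are column determinants\<close>

definition col :: "nat \<Rightarrow> nat list \<Rightarrow> 'a" where
  "col s T = creation_word (map (Pair s) T)"

definition row :: "nat \<Rightarrow> nat list \<Rightarrow> 'a" where
  "row s S = annihilation_word (map (Pair s) S)"

lemma col_simps [simp]: "col s [] = 1" "col s (t # T) = vp s t * col s T"
  by (simp_all add: col_def)

lemma row_simps [simp]: "row s [] = 1" "row s (t # T) = pv t s * row s T" "row s (S @ T) = row s S * row s T"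
  by (simp_all add: row_def)

text \<open>
  The generator acts on the product as a derivation that replaces a factor with index \<open>i\<close> by one with
  index \<open>j\<close>. The new factor is moved to the front, which turns the sum over the
  positions of \<open>i\<close> into a signed one, the contraction by \<open>i\<close>.
\<close>

lemma pp_col:
  assumes "s \<in> {1..m0}" "i \<in> {1..n}" "j \<in> {1..n}" "set T \<subseteq> {1..n}"
  shows "pp i j * col s T = col s T * pp i j - vp s j * expand (delta i) (col s) T"
  using assms(4)
proof (induction T)
  case (Cons t T)
  then have t: "t \<in> {1..n}" by simp
  have ex: "expand (delta i) (\<lambda>U. col s (t # U)) T = vp s t * expand (delta i) (col s) T"
    using expand_mult_left[of "delta i" "vp s t" "col s" T] by simp
  have "pp i j * col s (t # T) = vp s t * (pp i j * col s T) - delta i t * (vp s j * col s T)"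
    unfolding col_simps mult.assoc[symmetric] pp_vp[OF assms(2,3) t assms(1)]
    by (simp add: left_diff_distrib mult.assoc)
  also have "pp i j * col s T = col s T * pp i j - vp s j * expand (delta i) (col s) T"
    using Cons by simp
  also have "vp s t * (col s T * pp i j - vp s j * expand (delta i) (col s) T)
     = col s (t # T) * pp i j + vp s j * (vp s t * expand (delta i) (col s) T)"
    using vp_vp[OF t assms(3) assms(1,1)]
    by (simp add: right_diff_distrib mult.assoc[symmetric])
  finally show ?case
    unfolding expand.simps ex by (auto simp: algebra_simps)
qed simp

text \<open>
  The elements that can be dropped in front of \<open>g\<close> times a product of creating factors, for \<open>g\<close> in \<open>\<^bold>U(gl(n))\<close>.
  It is a left ideal and stable under right multiplication by \<open>\<^bold>U(gl(n))\<close>, so determinants can be expanded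
  modulo it. With \<open>ys\<close> empty it leads to the devirtualization itself, and with \<open>ys\<close> the right
  word of a tableau to a replacement of factors inside a longer product.
\<close>

definition annihilators :: "(nat \<times> nat) list \<Rightarrow> 'a set" where
  "annihilators ys = {x. \<forall>g\<in>proper_alg. x * g * creation_word ys \<in> Z}"

lemma annihilators_zero: "0 \<in> annihilators ys" and
  annihilators_add: "x \<in> annihilators ys \<Longrightarrow> y \<in> annihilators ys \<Longrightarrow> x + y \<in> annihilators ys" and
  annihilators_diff: "x \<in> annihilators ys \<Longrightarrow> y \<in> annihilators ys \<Longrightarrow> x - y \<in> annihilators ys" and
  annihilators_mult: "x \<in> annihilators ys \<Longrightarrow> z * x \<in> annihilators ys"
  by (simp_all add: annihilators_def Z_zero Z_add Z_diff Z_mult distrib_right left_diff_distrib mult.assoc)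

lemma annihilators_proper_alg_mult: "x \<in> annihilators ys \<Longrightarrow> g \<in> proper_alg \<Longrightarrow> x * g \<in> annihilators ys"
  unfolding annihilators_def mem_Collect_eq
proof
  fix h assume "\<forall>g\<in>proper_alg. x * g * creation_word ys \<in> Z" "g \<in> proper_alg" "h \<in> proper_alg"
  then have "x * (g * h) * creation_word ys \<in> Z" using proper_alg_mult by blast
  then show "x * g * h * creation_word ys \<in> Z" by (simp add: mult.assoc)
qed

lemma expand_annihilators:
  assumes "\<And>U. Suc (length U) = length T \<Longrightarrow> set U \<subseteq> set T \<Longrightarrow> g U \<in> annihilators ys"
    and "\<And>t. t \<in> set T \<Longrightarrow> f t \<in> proper_alg"
  shows "expand f g T \<in> annihilators ys"
  using assms
proof (induction T arbitrary: g)
  case (Cons t T)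
  have "expand f (\<lambda>U. g (t # U)) T \<in> annihilators ys"
  proof (rule Cons.IH)
    fix U assume "Suc (length U) = length T" "set U \<subseteq> set T"
    then show "g (t # U) \<in> annihilators ys" by (intro Cons.prems) auto
  qed (use Cons.prems in simp)
  moreover have "g T \<in> annihilators ys" by (rule Cons.prems) auto
  ultimately show ?case using Cons.prems(2)[of t] by (simp add: annihilators_diff annihilators_proper_alg_mult)
qed (simp add: annihilators_zero)

context
  fixes s :: nat and ys :: "(nat \<times> nat) list"
  assumes s: "s \<in> {1..m0}" and ys: "set ys \<subseteq> {1..m0} \<times> {1..n}" "s \<notin> fst ` set ys"
begin

lemma annihilator_in_annihilators: "a \<in> symbols m0 n \<Longrightarrow> e a (Virtual s) \<in> annihilators ys"
  using annihilator_in_Z[OF _ _ s ys] by (simp add: annihilators_def)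

text \<open>
  The diagonal element \<open>vv s s\<close> counts the symbols \<open>s\<close>. This is the origin of the shifts.
\<close>

lemma vv_col:
  assumes "set T \<subseteq> {1..n}"
  shows "vv s s * col s T - of_nat (length T) * col s T \<in> annihilators ys"
  using assms
proof (induction T)
  case Nil
  then show ?case using annihilator_in_annihilators[of "Virtual s"] s by simp
next
  case (Cons t T)
  then have t: "t \<in> {1..n}" by simp
  have "vv s s * col s (t # T) - of_nat (length (t # T)) * col s (t # T)
     = vp s t * (vv s s * col s T - of_nat (length T) * col s T)"
    unfolding col_simps mult.assoc[symmetric] vv_vp[OF s s s t]
    by (simp add: algebra_simps) (metis mult.assoc mult_of_nat_commute)
  then show ?case using Cons by (auto intro: annihilators_mult)
qed

text \<open>
  Moving \<open>pv i s\<close> to the right over the factor with index \<open>t\<close> leaves \<open>pp i t\<close>, and for \<open>i = t\<close> also the counting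
  element \<open>vv s s\<close>. The latter contributes the number of factors to the right of the one with index \<open>i\<close>. Each
  factor to the left of it, with index \<open>t\<close>, leaves a \<open>pp i t\<close> that passes the factor with index \<open>i\<close> on its way to
  the far right and contributes one more, by \<open>pp_col\<close>. Together this makes the shift \<open>length T - 1\<close>, wherever
  \<open>i\<close> occurs in \<open>T\<close>.
\<close>

lemma pv_col:
  assumes "i \<in> {1..n}" "set T \<subseteq> {1..n}"
  shows "pv i s * col s T
     - expand (\<lambda>t. pp i t + delta i t * of_int (0 + int (length T) - 1)) (col s) T \<in> annihilators ys"
  using assms(2)
proof (induction T)
  case Nil
  then show ?case using annihilator_in_annihilators[of "Proper i"] assms by simp
next
  case (Cons t T)
  then have t: "t \<in> {1..n}" and T: "set T \<subseteq> {1..n}" by auto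
  let ?f = "\<lambda>t. pp i t + delta i t * of_int (0 + int (length T) - 1)"
  have f: "(\<lambda>t'. pp i t' + delta i t' * of_int (0 + int (length (t # T)) - 1)) = (\<lambda>t'. ?f t' + delta i t')"
    by (auto simp: fun_eq_iff)
  have ex: "expand h (\<lambda>U. col s (t # U)) T = vp s t * expand h (col s) T" for h
    using expand_mult_left[of h "vp s t" "col s" T] by simp
  have "pv i s * col s (t # T) - expand (\<lambda>t'. ?f t' + delta i t') (col s) (t # T)
      = delta i t * (vv s s * col s T - of_nat (length T) * col s T)
        - vp s t * (pv i s * col s T - expand ?f (col s) T)"
  proof -
    have 1: "pv i s * col s (t # T) = pp i t * col s T + delta i t * (vv s s * col s T) - vp s t * (pv i s * col s T)"
      unfolding col_simps mult.assoc[symmetric] pv_vp[OF assms(1) t s s]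
      by (simp add: algebra_simps)
    have 2: "expand (\<lambda>t'. ?f t' + delta i t') (col s) (t # T)
      = col s T * pp i t + delta i t * (of_nat (length T) * col s T) - vp s t * (expand ?f (col s) T)
         - vp s t * expand (delta i) (col s) T"
      unfolding expand.simps ex expand_weight_add[of ?f]
      by (auto simp: algebra_simps mult_of_nat_commute)
    show ?thesis
      unfolding 1 2 pp_col[OF s assms(1) t T] by (simp add: algebra_simps)
  qed
  moreover have "delta i t * (vv s s * col s T - of_nat (length T) * col s T) \<in> annihilators ys"
    using vv_col[OF T] by (rule annihilators_mult)
  moreover have "vp s t * (pv i s * col s T - expand ?f (col s) T) \<in> annihilators ys"
    using Cons.IH[OF T] by (rule annihilators_mult)
  ultimately show ?case unfolding f by (simp only: annihilators_diff)
qed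

text \<open>
  The factors of \<open>row s (rev S)\<close> act one after the other, and each of them expands along one row.
\<close>

lemma row_col:
  assumes "length S = length T" "set S \<subseteq> {1..n}" "set T \<subseteq> {1..n}"
  shows "row s (rev S) * col s T - cminor pp 0 S T \<in> annihilators ys"
  using assms
proof (induction S arbitrary: T)
  case (Cons i S)
  then have i: "i \<in> {1..n}" by simp
  let ?f = "\<lambda>t. pp i t + delta i t * of_int (0 + int (length T) - 1)"
  let ?x = "row s (rev S)"
  have "?x * (pv i s * col s T - expand ?f (col s) T) \<in> annihilators ys"
    using Cons.prems by (intro annihilators_mult pv_col[OF i]) auto
  moreover have "expand ?f (\<lambda>U. ?x * col s U - cminor pp 0 S U) T \<in> annihilators ys"
  proof (rule expand_annihilators)
    fix U assume "Suc (length U) = length T" "set U \<subseteq> set T"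
    with Cons.prems show "?x * col s U - cminor pp 0 S U \<in> annihilators ys" by (intro Cons.IH) auto
  next
    fix t assume "t \<in> set T"
    then show "?f t \<in> proper_alg" using Cons.prems i
      by (intro proper_alg_add proper_alg_gen proper_alg_mult proper_alg_of_int) (auto simp: of_bool_def proper_alg_zero proper_alg_one)
  qed
  moreover have "row s (rev (i # S)) * col s T - cminor pp 0 (i # S) T
      = ?x * (pv i s * col s T - expand ?f (col s) T) + expand ?f (\<lambda>U. ?x * col s U - cminor pp 0 S U) T"
    by (simp add: expand_diff expand_mult_left algebra_simps)
  ultimately show ?case using annihilators_add by simp
qed (auto simp: annihilators_zero)

end

lemma annihilators_apply: "x \<in> annihilators ys \<Longrightarrow> x * creation_word ys \<in> Z"
  using proper_alg_one by (force simp: annihilators_def)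

lemma cminor_in_proper_alg:
  assumes "set S \<subseteq> {1..n}" "set T \<subseteq> {1..n}"
  shows "cminor pp c S T \<in> proper_alg"
proof -
  have ex: "expand f g T \<in> proper_alg" if "\<And>U. set U \<subseteq> set T \<Longrightarrow> g U \<in> proper_alg" "\<And>t. t \<in> set T \<Longrightarrow> f t \<in> proper_alg"
    for f g and T :: "nat list"
    using that
  proof (induction T arbitrary: g)
    case (Cons t T)
    have "expand f (\<lambda>U. g (t # U)) T \<in> proper_alg"
      by (rule Cons.IH) (auto intro!: Cons.prems)
    then show ?case using Cons.prems by (auto intro!: proper_alg_diff proper_alg_mult)
  qed (simp add: proper_alg_zero)
  show ?thesis
    using assms
  proof (induction S arbitrary: T)
    case (Cons i S)
    then show ?case
      by (auto intro!: ex proper_alg_add proper_alg_gen proper_alg_mult proper_alg_of_int proper_alg_diff proper_alg_of_nat proper_alg_one simp: of_bool_def proper_alg_zero proper_alg_one)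
  qed (auto simp: proper_alg_one proper_alg_zero)
qed

lemma pminor_in_proper_alg: "M \<subseteq> {1..n} \<Longrightarrow> pminor pp c M \<in> proper_alg"
  using finite_subset[of M "{1..n}"] unfolding pminor_def by (intro cminor_in_proper_alg) simp_all

subsection \<open>Balanced products lie in the domain of the devirtualization\<close>

text \<open>
  The elements which, modulo \<open>Z\<close>, are sums of products of \<open>k\<close> creating factors and an element of \<open>\<^bold>U(gl(n))\<close>.
  Annihilating factors lower \<open>k\<close> by one, so that a product of as many annihilating as creating factors
  ends in degree \<open>0\<close>, that is, in \<open>\<^bold>U(gl(n)) + Z\<close>.
\<close>

inductive_set created :: "nat \<Rightarrow> 'a set" for k where
  created_Z: "z \<in> Z \<Longrightarrow> z \<in> created k"
| created_gen: "length ys = k \<Longrightarrow> set ys \<subseteq> {1..m0} \<times> {1..n} \<Longrightarrow> g \<in> proper_alg \<Longrightarrow> creation_word ys * g \<in> created k"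
| created_add: "x \<in> created k \<Longrightarrow> y \<in> created k \<Longrightarrow> x + y \<in> created k"

lemma created_uminus: "x \<in> created k \<Longrightarrow> - x \<in> created k"
proof (induction rule: created.induct)
  case (created_gen ys g)
  then show ?case using created.created_gen[of ys k "- g"] proper_alg_uminus by simp
next
  case (created_add x y)
  then show ?case using created.created_add[of "- x" k "- y"] by simp
qed (auto intro: created_Z Z_uminus)

lemma created_diff: "x \<in> created k \<Longrightarrow> y \<in> created k \<Longrightarrow> x - y \<in> created k"
  using created_add[of x k "- y"] created_uminus by simp

lemma created_delta: "x \<in> created k \<Longrightarrow> of_bool b * x \<in> created k"
  by (simp add: created_Z Z_zero)

lemma vp_created: "x \<in> created k \<Longrightarrow> s \<in> {1..m0} \<Longrightarrow> i \<in> {1..n} \<Longrightarrow> vp s i * x \<in> created (Suc k)"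
proof (induction rule: created.induct)
  case (created_gen ys g)
  then show ?case using created.created_gen[of "(s, i) # ys" "Suc k" g] by (simp add: mult.assoc)
qed (auto simp: distrib_left intro: created_Z Z_mult created.created_add)

lemma annihilator_proper_alg_in_Z: "g \<in> proper_alg \<Longrightarrow> a \<in> symbols m0 n \<Longrightarrow> s \<in> {1..m0} \<Longrightarrow> e a (Virtual s) * g \<in> Z"
  using annihilator_in_Z[of g a s "[]"] by simp

lemma pp_creation_word:
  assumes "set ys \<subseteq> {1..m0} \<times> {1..n}" "g \<in> proper_alg" "i \<in> {1..n}" "j \<in> {1..n}"
  shows "pp i j * (creation_word ys * g) \<in> created (length ys)"
  using assms(1)
proof (induction ys)
  case Nil
  have "pp i j * g \<in> proper_alg" using assms by (intro proper_alg_mult proper_alg_gen)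
  then show ?case using created_gen[of "[]" 0 "pp i j * g"] by simp
next
  case (Cons y ys)
  obtain s t where y: "y = (s, t)" "s \<in> {1..m0}" "t \<in> {1..n}" using Cons by auto
  have "pp i j * (creation_word (y # ys) * g) = vp s t * (pp i j * (creation_word ys * g)) - delta i t * (vp s j * (creation_word ys * g))"
    unfolding y creation_word_simps fst_conv snd_conv mult.assoc[symmetric] pp_vp[OF assms(3,4) y(3,2)]
    by (simp add: left_diff_distrib)
  then show ?case using Cons y assms by (auto intro!: created_diff vp_created created_delta created_gen)
qed

lemma vv_creation_word:
  assumes "set ys \<subseteq> {1..m0} \<times> {1..n}" "g \<in> proper_alg" "s' \<in> {1..m0}" "t' \<in> {1..m0}"
  shows "vv s' t' * (creation_word ys * g) \<in> created (length ys)"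
  using assms(1)
proof (induction ys)
  case Nil
  then show ?case using annihilator_proper_alg_in_Z[of g "Virtual s'" t'] assms by (auto intro: created_Z)
next
  case (Cons y ys)
  obtain s t where y: "y = (s, t)" "s \<in> {1..m0}" "t \<in> {1..n}" using Cons by auto
  have "vv s' t' * (creation_word (y # ys) * g) = vp s t * (vv s' t' * (creation_word ys * g)) + delta t' s * (vp s' t * (creation_word ys * g))"
    unfolding y creation_word_simps fst_conv snd_conv mult.assoc[symmetric] vv_vp[OF assms(3,4) y(2,3)]
    by (simp add: distrib_right)
  then show ?case using Cons y assms by (auto intro!: created_add vp_created created_delta created_gen)
qed

lemma pv_creation_word:
  assumes "set ys \<subseteq> {1..m0} \<times> {1..n}" "g \<in> proper_alg" "i \<in> {1..n}" "s' \<in> {1..m0}" "ys \<noteq> []"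
  shows "pv i s' * (creation_word ys * g) \<in> created (length ys - 1)"
  using assms(1,5)
proof (induction ys)
  case (Cons y ys)
  obtain s t where y: "y = (s, t)" "s \<in> {1..m0}" "t \<in> {1..n}" using Cons by auto
  have t1: "vp s t * (pv i s' * (creation_word ys * g)) \<in> created (length ys)"
  proof (cases "ys = []")
    case True
    then show ?thesis using annihilator_proper_alg_in_Z[of g "Proper i" s'] assms by (auto intro: created_Z Z_mult)
  next
    case False
    then have "pv i s' * (creation_word ys * g) \<in> created (length ys - 1)" using Cons by simp
    from vp_created[OF this y(2,3)] show ?thesis using False by simp
  qed
  have eq: "pv i s' * (creation_word (y # ys) * g) = delta s' s * (pp i t * (creation_word ys * g))
      + delta i t * (vv s s' * (creation_word ys * g)) - vp s t * (pv i s' * (creation_word ys * g))"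
    unfolding y creation_word_simps fst_conv snd_conv mult.assoc[symmetric] pv_vp[OF assms(3) y(3) assms(4) y(2)]
    by (simp add: distrib_right left_diff_distrib)
  have t2: "delta s' s * (pp i t * (creation_word ys * g)) \<in> created (length ys)"
    and t3: "delta i t * (vv s s' * (creation_word ys * g)) \<in> created (length ys)"
    by (rule created_delta, rule pp_creation_word vv_creation_word; use Cons.prems y assms in simp)+
  have len: "length (y # ys) - 1 = length ys" by simp
  show ?case unfolding eq len by (intro created_diff created_add t1 t2 t3)
qed simp

lemma pv_created: "x \<in> created (Suc k) \<Longrightarrow> i \<in> {1..n} \<Longrightarrow> s \<in> {1..m0} \<Longrightarrow> pv i s * x \<in> created k"
proof (induction rule: created.induct)
  case (created_gen ys g)
  then show ?case using pv_creation_word[of ys g i s] by force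
qed (auto simp: distrib_left intro: created_Z Z_mult created.created_add)

lemma annihilation_word_created: "x \<in> created (length xs) \<Longrightarrow> set xs \<subseteq> {1..m0} \<times> {1..n} \<Longrightarrow> annihilation_word xs * x \<in> created 0"
proof (induction xs arbitrary: x rule: rev_induct)
  case (snoc y xs)
  then have "pv (snd y) (fst y) * x \<in> created (length xs)" by (intro pv_created) auto
  from snoc.IH[OF this] snoc.prems show ?case by (simp add: mult.assoc)
qed simp

lemma created_0: "x \<in> created 0 \<Longrightarrow> \<exists>a\<in>proper_alg. x - a \<in> Z"
proof (induction rule: created.induct)
  case (created_Z z)
  then show ?case using proper_alg_zero by force
next
  case (created_gen ys g)
  then show ?case using Z_zero by force
next
  case (created_add x y)
  then obtain a b where "a \<in> proper_alg" "b \<in> proper_alg" "x - a \<in> Z" "y - b \<in> Z" by auto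
  then show ?case by (intro bexI[of _ "a + b"]) (auto simp: add_diff_add intro: Z_add proper_alg_add)
qed

lemma balanced_in_Virt:
  assumes "length xs = length ys" "set xs \<subseteq> {1..m0} \<times> {1..n}" "set ys \<subseteq> {1..m0} \<times> {1..n}"
  shows "\<exists>a\<in>proper_alg. annihilation_word xs * creation_word ys - a \<in> Z"
  using annihilation_word_created[of "creation_word ys" xs] created_gen[of ys "length xs" 1] assms proper_alg_one by (intro created_0) auto

subsection \<open>Moving determinants over the left word\<close>

lemma pv_commute_row:
  assumes "set S \<subseteq> {1..n}" "i \<in> {1..n}" "s \<in> {1..m0}"
  shows "pv i s * row s S = (-1) ^ length S * (row s S * pv i s)"
proof -
  have "x * y = - (y * x)" if "x \<in> set [pv i s]" "y \<in> set (map (\<lambda>j. pv j s) S)" for x y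
    using that assms by (auto intro!: pv_pv)
  from prod_list_anticommute[of "[pv i s]" "map (\<lambda>j. pv j s) S", OF this] show ?thesis
    by (simp add: row_def annihilation_word_def comp_def)
qed

lemma row_repeated:
  assumes "set S \<subseteq> {1..n}" "s \<in> {1..m0}" "\<not> distinct S"
  shows "row s S = 0"
proof -
  from not_distinct_decomp[OF assms(3)] obtain xs ys zs i
    where S: "S = xs @ [i] @ ys @ [i] @ zs" by (elim exE)
  then have i: "i \<in> {1..n}" using assms(1) by auto
  have sq: "pv i s * pv i s = 0"
    by (rule double_zero, rule iffD1[OF eq_neg_iff_add_eq_0 pv_pv[OF i i assms(2,2)]])
  have "pv i s * row s ys = (-1) ^ length ys * (row s ys * pv i s)"
    using assms i S by (intro pv_commute_row) auto
  then have "pv i s * row s ys * pv i s = 0"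
    by (simp only: mult.assoc sq mult_zero_right)
  then have "row s xs * (pv i s * row s ys * pv i s) * row s zs = 0" by simp
  then show ?thesis by (simp add: S mult.assoc)
qed

lemma pp_row_notin:
  assumes "set S \<subseteq> {1..n}" "s \<in> {1..m0}" "i \<in> {1..n}" "j \<in> {1..n}" "j \<notin> set S"
  shows "pp i j * row s S = row s S * pp i j"
  using assms(1,5)
proof (induction S)
  case (Cons k S)
  then have "pp i j * pv k s = pv k s * pp i j"
    using pp_pv[OF assms(3,4) _ assms(2), of k] by auto
  then have "pp i j * row s (k # S) = pv k s * (pp i j * row s S)"
    by (simp flip: mult.assoc)
  then show ?case using Cons by (simp add: mult.assoc)
qed simp

text \<open>
  The bracket with \<open>pp i j\<close> replaces the single factor with index \<open>j\<close> by one with index \<open>i\<close>. As \<open>i\<close> also occurs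
  in \<open>S\<close>, this creates a repetition unless \<open>i = j\<close>.
\<close>

lemma pp_row:
  assumes "set S \<subseteq> {1..n}" "s \<in> {1..m0}" "distinct S" "i \<in> set S" "j \<in> set S"
  shows "pp i j * row s S = row s S * (pp i j + delta i j)"
proof -
  obtain S1 S2 where S: "S = S1 @ j # S2" using assms(5) by (meson split_list)
  have ij: "i \<in> {1..n}" "j \<in> {1..n}" using assms by auto
  have "pp i j * row s S = row s S1 * (pp i j * pv j s) * row s S2"
    using pp_row_notin[of S1 s i j] assms ij by (simp add: S flip: mult.assoc)
  also have "pp i j * pv j s = pv j s * pp i j + pv i s"
    using pp_pv[OF ij ij(2) assms(2)] by simp
  also have "row s S1 * (pv j s * pp i j + pv i s) * row s S2
      = row s S1 * pv j s * (pp i j * row s S2) + row s (S1 @ i # S2)"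
    by (simp add: distrib_left distrib_right mult.assoc)
  also have "pp i j * row s S2 = row s S2 * pp i j"
    using assms ij by (intro pp_row_notin) (auto simp: S)
  also have "row s (S1 @ i # S2) = row s S * delta i j"
  proof (cases "i = j")
    case False
    then have "row s (S1 @ i # S2) = 0"
      using assms by (intro row_repeated) (auto simp: S)
    then show ?thesis using False by simp
  qed (simp add: S)
  finally show ?thesis by (simp add: S mult.assoc distrib_left)
qed

lemma pp_deruyts_left:
  assumes "length lam \<le> m0" "\<forall>l\<in>set lam. l \<le> n \<and> i \<le> l \<and> j \<le> l" "i \<ge> 1" "j \<ge> 1"
  shows "pp i j * annihilation_word (cells (deruyts_left lam))
    = annihilation_word (cells (deruyts_left lam)) * (pp i j + delta i j * of_nat (length lam))"
  using assms(1,2)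
proof (induction lam rule: rev_induct)
  case (snoc l lam)
  define c where "c = annihilation_word (cells (deruyts_left lam))"
  define r where "r = row (Suc (length lam)) (rev [1..<Suc l])"
  have cr: "annihilation_word (cells (deruyts_left (lam @ [l]))) = c * r"
    by (simp add: deruyts_left_def cells_snoc row_def c_def r_def del: upt_Suc)
  have r: "pp i j * r = r * (pp i j + delta i j)"
    unfolding r_def using snoc.prems assms(3,4) by (intro pp_row) auto
  have c: "pp i j * c = c * (pp i j + delta i j * of_nat (length lam))"
    using snoc by (simp add: c_def)
  have k: "of_nat (length lam) * r = r * of_nat (length lam)"
    by (rule mult_of_nat_commute)
  have "pp i j * (c * r) = c * (pp i j * r) + c * (delta i j * (of_nat (length lam) * r))"
    unfolding mult.assoc[symmetric] c by (simp add: distrib_left distrib_right mult.assoc)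
  also have "\<dots> = c * r * (pp i j + delta i j * of_nat (length (lam @ [l])))"
    unfolding r k by (simp add: distrib_left mult.assoc)
  finally show ?case unfolding cr .
qed (simp add: deruyts_left_def)

lemma deruyts_left_cminor:
  assumes "length lam \<le> m0" "\<forall>l\<in>set lam. l \<le> n \<and> k \<le> l" "set S \<subseteq> {1..k}" "set T \<subseteq> {1..k}"
  shows "annihilation_word (cells (deruyts_left lam)) * cminor pp c S T
    = cminor pp (c - int (length lam)) S T * annihilation_word (cells (deruyts_left lam))"
  using assms(3,4)
proof (induction S arbitrary: T)
  case (Cons i S)
  let ?C = "annihilation_word (cells (deruyts_left lam))"
  let ?f = "\<lambda>c t. pp i t + delta i t * of_int (c + int (length T) - 1) :: 'a"
  have "?C * expand (?f c) (cminor pp c S) T = expand (?f c) (\<lambda>U. ?C * cminor pp c S U) T"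
    by (simp add: expand_mult_left)
  also have "\<dots> = expand (?f c) (\<lambda>U. cminor pp (c - int (length lam)) S U * ?C) T"
    using Cons by (intro expand_cong) auto
  also have "\<dots> = expand (?f (c - int (length lam))) (cminor pp (c - int (length lam)) S) T * ?C"
  proof (rule expand_mult_right)
    fix t assume "t \<in> set T"
    then have "pp i t * ?C = ?C * (pp i t + delta i t * of_nat (length lam))"
      using assms Cons.prems by (intro pp_deruyts_left) (auto dest!: bspec[OF assms(2)])
    moreover have "of_int z * ?C = ?C * of_int z" for z
      by (rule mult_of_int_commute)
    moreover have "(of_int (c + int (length T) - 1) :: 'a)
        = of_nat (length lam) + of_int (c - int (length lam) + int (length T) - 1)"
      by simp
    ultimately show "?C * ?f c t = ?f (c - int (length lam)) t * ?C"
      by (cases "i = t") (simp_all only: of_bool_eq simp_thms mult_1_left mult_zero_left add_0_right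
        distrib_left distrib_right add.assoc)
  qed
  finally show ?case by simp
qed simp

text \<open>
  The theorem modulo irregular products, for any representative \<open>u\<close> of \<open>\<^bold>K\<^sup>\<lambda>\<close>. The sum on its right-hand side
  is still packed into the shifted minor.
\<close>

theorem deruyts_row_mod_Z:
  assumes "lam \<noteq> []" "\<forall>l\<in>set lam. l \<le> n \<and> k \<le> l" "M \<subseteq> {1..k}" "m0 \<ge> length lam + 1"
    and u: "u - annihilation_word (cells (deruyts_left lam)) * creation_word (cells (deruyts_right lam)) \<in> Z"
  shows "annihilation_word (cells (deruyts_left lam @ [rev (sorted_list_of_set M)]))
         * creation_word (cells (deruyts_right lam @ [sorted_list_of_set M]))
       - (-1) ^ (sum_list lam * card M) * (pminor pp (- int (length lam)) M * u) \<in> Z"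
proof -
  define b where "b = Suc (length lam)"
  define T where "T = sorted_list_of_set M"
  define ys where "ys = cells (deruyts_right lam)"
  let ?C = "annihilation_word (cells (deruyts_left lam))"
  let ?p = "int (length lam)"
  have M: "finite M" using assms(3) finite_subset by blast
  have k: "k \<le> n" using assms(1,2) by (cases lam) auto
  have T: "set T \<subseteq> {1..k}" "length T = card M" using M assms(3) by (auto simp: T_def)
  then have Tn: "set T \<subseteq> {1..n}" using k by auto
  have b: "b \<in> {1..m0}" using assms(4) by (auto simp: b_def)
  have ys: "set ys \<subseteq> {1..m0} \<times> {1..n}" "b \<notin> fst ` set ys"
    using assms(2,4) cells_bounds[of _ _ "deruyts_right lam"]
    by (force simp: ys_def b_def deruyts_right_def)+
  have len: "length ys = sum_list lam"
    by (simp add: ys_def length_cells deruyts_right_def comp_def del: upt_Suc)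
  have anti: "creation_word ys * col b T = (-1) ^ (sum_list lam * card M) * (col b T * creation_word ys)"
  proof -
    have "x * y = - (y * x)"
      if "x \<in> set (map (\<lambda>(s, t). vp s t) ys)" "y \<in> set (map (\<lambda>t. vp b t) T)" for x y
      using that ys Tn b by (auto intro!: vp_vp)
    from prod_list_anticommute[of "map (\<lambda>(s, t). vp s t) ys" "map (\<lambda>t. vp b t) T", OF this]
    show ?thesis by (simp add: creation_word_def col_def comp_def len T(2))
  qed
  have shift: "?C * cminor pp 0 T T = cminor pp (- ?p) T T * ?C"
    using deruyts_left_cminor[OF _ assms(2) T(1) T(1), of 0] assms(4) by simp
  have "?C * ((row b (rev T) * col b T - cminor pp 0 T T) * creation_word ys)
      = ?C * row b (rev T) * col b T * creation_word ys - cminor pp (- ?p) T T * (?C * creation_word ys)"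
    unfolding mult.assoc[symmetric] shift[symmetric]
    by (simp add: left_diff_distrib right_diff_distrib mult.assoc)
  moreover have "?C * ((row b (rev T) * col b T - cminor pp 0 T T) * creation_word ys) \<in> Z"
    by (rule Z_mult[OF annihilators_apply[OF row_col[OF b ys refl Tn Tn]]])
  ultimately have "?C * row b (rev T) * col b T * creation_word ys - cminor pp (- ?p) T T * (?C * creation_word ys) \<in> Z"
    by (simp only:)
  moreover have "cminor pp (- ?p) T T * (u - ?C * creation_word ys) \<in> Z"
    using u unfolding ys_def by (rule Z_mult)
  ultimately have "?C * row b (rev T) * col b T * creation_word ys - cminor pp (- ?p) T T * (?C * creation_word ys)
      - cminor pp (- ?p) T T * (u - ?C * creation_word ys) \<in> Z"
    by (rule Z_diff)
  then have "?C * row b (rev T) * col b T * creation_word ys - cminor pp (- ?p) T T * u \<in> Z"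
    by (simp add: right_diff_distrib)
  then have "(-1) ^ (sum_list lam * card M)
      * (?C * row b (rev T) * col b T * creation_word ys - cminor pp (- ?p) T T * u) \<in> Z"
    by (rule Z_mult)
  moreover have "annihilation_word (cells (deruyts_left lam @ [rev T])) * creation_word (cells (deruyts_right lam @ [T]))
      = (-1) ^ (sum_list lam * card M) * (?C * row b (rev T) * col b T * creation_word ys)"
  proof -
    have "annihilation_word (cells (deruyts_left lam @ [rev T])) * creation_word (cells (deruyts_right lam @ [T]))
        = ?C * row b (rev T) * (creation_word ys * col b T)"
      by (simp add: cells_snoc row_def col_def b_def ys_def deruyts_left_def deruyts_right_def mult.assoc)
    then show ?thesis
      unfolding anti by (cases "even (sum_list lam * card M)") (simp_all add: mult.assoc)
  qed
  ultimately show ?thesis by (simp add: pminor_def T_def right_diff_distrib)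
qed

theorem row_mod_Z:
  assumes "M \<subseteq> {1..n}" "m0 \<ge> 1"
  shows "annihilation_word (cells [rev (sorted_list_of_set M)]) * creation_word (cells [sorted_list_of_set M]) - pminor pp 0 M \<in> Z"
proof -
  have "finite M" using assms(1) finite_subset by blast
  then show ?thesis
    using annihilators_apply[OF row_col[of 1 "[]" "sorted_list_of_set M" "sorted_list_of_set M"]] assms
    by (simp add: cells_snoc[of "[]", simplified] row_def col_def pminor_def)
qed

end

section \<open>The action on functions of words\<close>

text \<open>
  A generator \<open>e\<^bsub>a,b\<^esub>\<close> acts on words by replacing one letter \<open>b\<close> by \<open>a\<close> in all possible ways, with the sign for
  passing the letters to the left. The dual right action on functions of words is used, \<open>(\<phi> e\<^bsub>a,b\<^esub>)(v) = \<phi>(e\<^bsub>a,b\<^esub> v)\<close>: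
  it needs no linear combinations of words.
\<close>

fun gen_act :: "symbol \<Rightarrow> symbol \<Rightarrow> (symbol list \<Rightarrow> complex) \<Rightarrow> symbol list \<Rightarrow> complex" where
  "gen_act a b \<phi> [] = 0"
| "gen_act a b \<phi> (x # v) = of_bool (x = b) * \<phi> (a # v)
     + (-1) ^ ((parity a + parity b) * parity x) * gen_act a b (\<lambda>u. \<phi> (x # u)) v"

lemma gen_act_add: "gen_act a b (\<lambda>u. \<phi> u + \<psi> u) v = gen_act a b \<phi> v + gen_act a b \<psi> v"
  by (induction v arbitrary: \<phi> \<psi>) (simp_all add: algebra_simps)

lemma gen_act_scale: "gen_act a b (\<lambda>u. c * \<phi> u) v = c * gen_act a b \<phi> v"
  by (induction v arbitrary: \<phi>) (simp_all add: algebra_simps)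

lemma parity_cases: "parity a = 0 \<or> parity a = 1"
  by (cases a) auto

text \<open>
  The tensor powers of the natural module are modules: the terms in which both generators hit the same
  letter make up the bracket, and those in which they hit different letters cancel because of the sign rule.
\<close>

lemma gen_act_relation:
  "gen_act c d (gen_act a b \<phi>) v - (-1) ^ ((parity a + parity b) * (parity c + parity d)) * gen_act a b (gen_act c d \<phi>) v
   = of_bool (b = c) * gen_act a d \<phi> v
     - (-1) ^ ((parity a + parity b) * (parity c + parity d)) * of_bool (a = d) * gen_act c b \<phi> v"
proof (induction v arbitrary: \<phi>)
  case (Cons x v)
  define sg :: "symbol \<Rightarrow> symbol \<Rightarrow> symbol \<Rightarrow> complex" where
    "sg = (\<lambda>a b x. (-1) ^ ((parity a + parity b) * parity x))"
  define s :: complex where "s = (-1) ^ ((parity a + parity b) * (parity c + parity d))"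
  have two: "gen_act c d (gen_act a b \<phi>) (x # v) = of_bool (x = d) * (of_bool (b = c) * \<phi> (a # v))
      + of_bool (x = d) * (sg a b c * gen_act a b (\<lambda>u. \<phi> (c # u)) v)
      + sg c d x * (of_bool (x = b) * gen_act c d (\<lambda>u. \<phi> (a # u)) v)
      + sg c d x * (sg a b x * gen_act c d (gen_act a b (\<lambda>u. \<phi> (x # u))) v)" for a b c d
    unfolding gen_act.simps gen_act_add gen_act_scale by (simp add: sg_def algebra_simps)
  have one: "gen_act a b \<phi> (x # v) = of_bool (x = b) * \<phi> (a # v) + sg a b x * gen_act a b (\<lambda>u. \<phi> (x # u)) v"
    for a b by (simp add: sg_def)
  let ?X = "gen_act c d (gen_act a b (\<lambda>u. \<phi> (x # u))) v"
  let ?Y = "gen_act a b (gen_act c d (\<lambda>u. \<phi> (x # u))) v"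
  let ?A = "gen_act a b (\<lambda>u. \<phi> (c # u)) v"
  let ?C = "gen_act c d (\<lambda>u. \<phi> (a # u)) v"
  let ?R = "\<lambda>a b. gen_act a b (\<lambda>u. \<phi> (x # u)) v"
  have X: "?X = s * ?Y + of_bool (b = c) * ?R a d - s * (of_bool (a = d) * ?R c b)"
    using Cons.IH[of "\<lambda>u. \<phi> (x # u)"] by (simp add: s_def algebra_simps)
  have par: "parity a = 0 \<or> parity a = 1" "parity b = 0 \<or> parity b = 1"
    "parity c = 0 \<or> parity c = 1" "parity d = 0 \<or> parity d = 1" "parity x = 0 \<or> parity x = 1"
    by (rule parity_cases)+
  have s1: "s * sg a b d = sg a b c" and s2: "s * sg c d a = sg c d b"
    using par(1-4) by (auto simp: s_def sg_def)
  have s3: "sg c d x * sg a b x = sg a d x" if "b = c"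
    using par that by (auto simp: sg_def)
  have s4: "sg c d x * sg a b x = sg c b x" if "a = d"
    using par that by (auto simp: sg_def)
  have t1: "of_bool (x = d) * (sg a b c * ?A) - s * sg a b x * (of_bool (x = d) * ?A) = 0"
    using s1 by auto
  have t2: "sg c d x * (of_bool (x = b) * ?C) - s * (of_bool (x = b) * (sg c d a * ?C)) = 0"
    using s2 by (auto simp flip: mult.assoc)
  have t3: "sg c d x * sg a b x * (of_bool (b = c) * ?R a d) - of_bool (b = c) * (sg a d x * ?R a d) = 0"
    using s3 by auto
  have t4: "s * (sg c d x * sg a b x * (of_bool (a = d) * ?R c b)) - s * (of_bool (a = d) * (sg c b x * ?R c b)) = 0"
    using s4 by auto
  have "gen_act c d (gen_act a b \<phi>) (x # v) - s * gen_act a b (gen_act c d \<phi>) (x # v)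
      - (of_bool (b = c) * gen_act a d \<phi> (x # v) - s * of_bool (a = d) * gen_act c b \<phi> (x # v))
    = (of_bool (x = d) * (sg a b c * ?A) - s * sg a b x * (of_bool (x = d) * ?A))
      + (sg c d x * (of_bool (x = b) * ?C) - s * (of_bool (x = b) * (sg c d a * ?C)))
      + (sg c d x * sg a b x * (of_bool (b = c) * ?R a d) - of_bool (b = c) * (sg a d x * ?R a d))
      - (s * (sg c d x * sg a b x * (of_bool (a = d) * ?R c b)) - s * (of_bool (a = d) * (sg c b x * ?R c b)))"
    unfolding two[of c d a b] two[of a b c d] one X eq_commute[of d a] by (simp only: algebra_simps)
  also have "\<dots> = 0"
    unfolding t1 t2 t3 t4 by simp
  finally show ?case
    unfolding s_def[symmetric] by (rule iffD2[OF eq_iff_diff_eq_0])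
qed simp

text \<open>
  A product acts from the right, so its leftmost factor acts first on the function.
\<close>

definition word_act :: "(symbol \<times> symbol) list \<Rightarrow> (symbol list \<Rightarrow> complex) \<Rightarrow> symbol list \<Rightarrow> complex" where
  "word_act w \<phi> = foldl (\<lambda>\<psi> (a, b). gen_act a b \<psi>) \<phi> w"

lemma word_act_simps [simp]:
  "word_act [] \<phi> = \<phi>" "word_act ((a, b) # w) \<phi> = word_act w (gen_act a b \<phi>)" "word_act (w @ w') \<phi> = word_act w' (word_act w \<phi>)"
  by (simp_all add: word_act_def)

lemma word_act_add: "word_act w (\<lambda>u. \<phi> u + \<psi> u) = (\<lambda>u. word_act w \<phi> u + word_act w \<psi> u)"
proof (induction w arbitrary: \<phi> \<psi>)
  case (Cons p w)
  have "gen_act (fst p) (snd p) (\<lambda>u. \<phi> u + \<psi> u)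
      = (\<lambda>u. gen_act (fst p) (snd p) \<phi> u + gen_act (fst p) (snd p) \<psi> u)"
    by (rule ext) (rule gen_act_add)
  then show ?case by (cases p) (simp add: Cons)
qed simp

lemma word_act_scale: "word_act w (\<lambda>u. c * \<phi> u) = (\<lambda>u. c * word_act w \<phi> u)"
proof (induction w arbitrary: \<phi>)
  case (Cons p w)
  have "gen_act (fst p) (snd p) (\<lambda>u. c * \<phi> u) = (\<lambda>u. c * gen_act (fst p) (snd p) \<phi> u)"
    by (rule ext) (rule gen_act_scale)
  then show ?case by (cases p) (simp add: Cons)
qed simp

definition act :: "free_elt \<Rightarrow> (symbol list \<Rightarrow> complex) \<Rightarrow> symbol list \<Rightarrow> complex" where
  "act f \<phi> v = (\<Sum>w\<in>Poly_Mapping.keys f. poly_mapping.lookup f w * word_act w \<phi> v)"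

lemma act_superset:
  "finite B \<Longrightarrow> Poly_Mapping.keys f \<subseteq> B \<Longrightarrow> act f \<phi> v = (\<Sum>w\<in>B. poly_mapping.lookup f w * word_act w \<phi> v)"
  unfolding act_def by (rule sum.mono_neutral_left) (auto simp: in_keys_iff)

lemma act_add: "act (f + g) \<phi> v = act f \<phi> v + act g \<phi> v"
proof -
  let ?B = "Poly_Mapping.keys f \<union> Poly_Mapping.keys g"
  have "act (f + g) \<phi> v = (\<Sum>w\<in>?B. poly_mapping.lookup (f + g) w * word_act w \<phi> v)"
    using Poly_Mapping.keys_add[of f g] by (intro act_superset) auto
  then show ?thesis
    using act_superset[of ?B f \<phi> v] act_superset[of ?B g \<phi> v]
    by (simp add: lookup_add distrib_right sum.distrib)
qed

lemma act_single: "act (Poly_Mapping.single w c) \<phi> v = c * word_act w \<phi> v"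
  using act_superset[of "{w}" "Poly_Mapping.single w c"] by (simp add: lookup_single)

lemma act_zero [simp]: "act 0 \<phi> v = 0"
  by (simp add: act_def)

lemma act_uminus: "act (- f) \<phi> v = - act f \<phi> v"
  using act_add[of f "- f" \<phi> v] by (simp add: eq_neg_iff_add_eq_0 add.commute)

lemma act_diff: "act (f - g) \<phi> v = act f \<phi> v - act g \<phi> v"
  using act_add[of f "- g" \<phi> v] by (simp add: act_uminus)

lemma act_sign: "act ((-1) ^ k * f) \<phi> v = (-1) ^ k * act f \<phi> v"
  by (cases "even k") (simp_all add: act_uminus)

lemma free_expansion: "f = (\<Sum>w\<in>Poly_Mapping.keys f. Poly_Mapping.single w (poly_mapping.lookup f w))"
  by (rule poly_mapping_eqI) (simp add: lookup_sum lookup_single when_def in_keys_iff)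

lemma free_induct [case_names single add zero]:
  fixes f :: "'b \<Rightarrow>\<^sub>0 complex"
  assumes "\<And>w c. w \<in> Poly_Mapping.keys f \<Longrightarrow> P (Poly_Mapping.single w c)" "\<And>f g. P f \<Longrightarrow> P g \<Longrightarrow> P (f + g)"
    "P 0"
  shows "P f"
proof -
  have "P (\<Sum>w\<in>B. Poly_Mapping.single w (poly_mapping.lookup f w))" if "B \<subseteq> Poly_Mapping.keys f" for B
    using finite_subset[OF that finite_keys] that
    by (induction B rule: finite_induct) (auto simp: assms)
  from this[OF subset_refl] show ?thesis by (simp flip: free_expansion)
qed

lemma act_fun_add: "act f (\<lambda>u. \<phi> u + \<psi> u) v = act f \<phi> v + act f \<psi> v"
  by (simp add: act_def word_act_add algebra_simps sum.distrib)

lemma act_fun_scale: "act f (\<lambda>u. c * \<phi> u) v = c * act f \<phi> v"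
  by (simp add: act_def word_act_scale sum_distrib_left algebra_simps)

lemma act_fun_zero: "act f (\<lambda>u. 0) v = 0"
  using act_fun_scale[of f 0 "\<lambda>_. 0"] by simp

lemma act_mult: "act (f * g) \<phi> v = act g (act f \<phi>) v"
proof (induction f arbitrary: \<phi> rule: free_induct)
  case (single w c)
  show ?case
  proof (induction g rule: free_induct)
    case (single w' c')
    have "act (Poly_Mapping.single w c) \<phi> = (\<lambda>u. c * word_act w \<phi> u)"
      by (rule ext) (rule act_single)
    then show ?case
      by (simp add: mult_single act_single word_act_scale plus_list_def)
  qed (simp_all add: distrib_left act_add)
next
  case (add f g')
  have "act (f + g') \<phi> = (\<lambda>u. act f \<phi> u + act g' \<phi> u)"
    by (rule ext) (rule act_add)
  with add show ?case by (simp add: distrib_right act_add act_fun_add)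
next
  case zero
  have "act 0 \<phi> = (\<lambda>u. 0)" by (rule ext) simp
  then show ?case by (simp add: act_fun_zero)
qed

lemma act_E: "act (E a b) \<phi> v = gen_act a b \<phi> v"
  by (simp add: E_def act_single)

lemma act_env_relation:
  "act (E a b * E c d - (-1) ^ ((parity a + parity b) * (parity c + parity d)) * (E c d * E a b)
        - superbracket a b c d) \<phi> v = 0"
proof -
  have E: "act (E a b) \<phi> = gen_act a b \<phi>" for a b \<phi> by (rule ext) (rule act_E)
  have if_act: "act (if P then f else 0) \<phi> v = of_bool P * act f \<phi> v" for P f by simp
  show ?thesis
    using gen_act_relation[of c d a b \<phi> v]
    unfolding superbracket_def act_diff act_sign if_act
    unfolding act_mult E act_E by (simp add: mult.assoc)
qed

section \<open>The enveloping algebra as a quotient\<close>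

context
  fixes m0 n :: nat
begin

lemma tensor_simps [simp]:
  "monoid.mult (tensor_alg m0 n) = (*)" "add (tensor_alg m0 n) = (+)"
  "one (tensor_alg m0 n) = 1" "zero (tensor_alg m0 n) = 0"
  by (simp_all add: tensor_alg_def)

lemma single_in_tensor: "set w \<subseteq> symbols m0 n \<times> symbols m0 n \<Longrightarrow> Poly_Mapping.single w c \<in> carrier (tensor_alg m0 n)"
  by (simp add: tensor_alg_def)

lemma tensor_closed:
  "f \<in> carrier (tensor_alg m0 n) \<Longrightarrow> g \<in> carrier (tensor_alg m0 n) \<Longrightarrow> f + g \<in> carrier (tensor_alg m0 n)"
  "f \<in> carrier (tensor_alg m0 n) \<Longrightarrow> g \<in> carrier (tensor_alg m0 n) \<Longrightarrow> f * g \<in> carrier (tensor_alg m0 n)"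
  "0 \<in> carrier (tensor_alg m0 n)" "1 \<in> carrier (tensor_alg m0 n)"
  "f \<in> carrier (tensor_alg m0 n) \<Longrightarrow> - f \<in> carrier (tensor_alg m0 n)"
proof -
  interpret ring "tensor_alg m0 n" by (rule tensor_alg_ring)
  show "f \<in> carrier (tensor_alg m0 n) \<Longrightarrow> g \<in> carrier (tensor_alg m0 n) \<Longrightarrow> f + g \<in> carrier (tensor_alg m0 n)"
    "f \<in> carrier (tensor_alg m0 n) \<Longrightarrow> g \<in> carrier (tensor_alg m0 n) \<Longrightarrow> f * g \<in> carrier (tensor_alg m0 n)"
    "0 \<in> carrier (tensor_alg m0 n)" "1 \<in> carrier (tensor_alg m0 n)"
    using a_closed[of f g] m_closed[of f g] zero_closed one_closed by simp_all
  show "f \<in> carrier (tensor_alg m0 n) \<Longrightarrow> - f \<in> carrier (tensor_alg m0 n)"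
    by (auto simp: tensor_alg_def in_keys_iff)
qed

lemma tensor_diff: "f \<in> carrier (tensor_alg m0 n) \<Longrightarrow> g \<in> carrier (tensor_alg m0 n) \<Longrightarrow> f - g \<in> carrier (tensor_alg m0 n)"
  using tensor_closed(1)[of f "- g"] tensor_closed(5)[of g] by simp

lemma tensor_a_inv: "f \<in> carrier (tensor_alg m0 n) \<Longrightarrow> \<ominus>\<^bsub>tensor_alg m0 n\<^esub> f = - f"
proof -
  interpret ring "tensor_alg m0 n" by (rule tensor_alg_ring)
  assume "f \<in> carrier (tensor_alg m0 n)"
  then show ?thesis
    using minus_equality[of "- f" f] tensor_closed(5)[of f] by simp
qed

lemma sign_in_tensor: "(-1) ^ k \<in> carrier (tensor_alg m0 n)"
  by (cases "even k") (auto intro: tensor_closed)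

lemma E_in_tensor: "a \<in> symbols m0 n \<Longrightarrow> b \<in> symbols m0 n \<Longrightarrow> E a b \<in> carrier (tensor_alg m0 n)"
  unfolding E_def by (rule single_in_tensor) auto

lemma env_relations_subset: "env_relations m0 n \<subseteq> carrier (tensor_alg m0 n)"
  by (auto simp: env_relations_def superbracket_def intro!: tensor_diff tensor_closed E_in_tensor sign_in_tensor)

lemma ideal_env: "ideal (env_ideal m0 n) (tensor_alg m0 n)"
  unfolding env_ideal_def by (rule ring.genideal_ideal[OF tensor_alg_ring env_relations_subset])

lemma env_ideal_closed:
  "0 \<in> env_ideal m0 n"
  "f \<in> env_ideal m0 n \<Longrightarrow> g \<in> env_ideal m0 n \<Longrightarrow> f + g \<in> env_ideal m0 n"
  "f \<in> env_ideal m0 n \<Longrightarrow> g \<in> carrier (tensor_alg m0 n) \<Longrightarrow> f * g \<in> env_ideal m0 n"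
  "f \<in> env_ideal m0 n \<Longrightarrow> g \<in> carrier (tensor_alg m0 n) \<Longrightarrow> g * f \<in> env_ideal m0 n"
  "f \<in> env_ideal m0 n \<Longrightarrow> f \<in> carrier (tensor_alg m0 n)"
  "f \<in> env_ideal m0 n \<Longrightarrow> - f \<in> env_ideal m0 n"
proof -
  interpret ideal "env_ideal m0 n" "tensor_alg m0 n" by (rule ideal_env)
  show "0 \<in> env_ideal m0 n" using additive_subgroup.zero_closed[OF is_additive_subgroup] by simp
  show "f + g \<in> env_ideal m0 n" if "f \<in> env_ideal m0 n" "g \<in> env_ideal m0 n" using additive_subgroup.a_closed[OF is_additive_subgroup that] by simp
  show "f * g \<in> env_ideal m0 n" if "f \<in> env_ideal m0 n" "g \<in> carrier (tensor_alg m0 n)" using I_r_closed[OF that] by simp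
  show "g * f \<in> env_ideal m0 n" if "f \<in> env_ideal m0 n" "g \<in> carrier (tensor_alg m0 n)" using I_l_closed[OF that] by simp
  show c: "f \<in> carrier (tensor_alg m0 n)" if "f \<in> env_ideal m0 n" using that by (rule a_Hcarr)
  show "- f \<in> env_ideal m0 n" if "f \<in> env_ideal m0 n" using I_l_closed[OF that tensor_closed(5)[OF tensor_closed(4)]] by simp
qed

lemma env_ideal_relation:
  "{a, b, c, d} \<subseteq> symbols m0 n \<Longrightarrow>
   E a b * E c d - (-1) ^ ((parity a + parity b) * (parity c + parity d)) * (E c d * E a b)
        - superbracket a b c d \<in> env_ideal m0 n"
  unfolding env_ideal_def
  by (rule subsetD[OF ring.genideal_self[OF tensor_alg_ring env_relations_subset]])
    (auto simp: env_relations_def)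

text \<open>
  The elements of the free algebra that act as zero form an ideal, and it contains the defining relations.
\<close>

lemma act_env_ideal: "f \<in> env_ideal m0 n \<Longrightarrow> act f \<phi> v = 0"
proof -
  interpret ring "tensor_alg m0 n" by (rule tensor_alg_ring)
  let ?J = "{f \<in> carrier (tensor_alg m0 n). \<forall>\<phi> v. act f \<phi> v = 0}"
  have "ideal ?J (tensor_alg m0 n)"
  proof (rule idealI[OF tensor_alg_ring])
    show "subgroup ?J (add_monoid (tensor_alg m0 n))"
    proof (rule subgroup.intro)
      fix x assume x: "x \<in> ?J"
      then have "inv\<^bsub>add_monoid (tensor_alg m0 n)\<^esub> x = - x" using tensor_a_inv[of x] by (simp add: a_inv_def)
      then show "inv\<^bsub>add_monoid (tensor_alg m0 n)\<^esub> x \<in> ?J" using x by (simp add: tensor_closed act_uminus)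
    qed (auto simp: tensor_closed act_add)
  next
    fix a x assume "a \<in> ?J" "x \<in> carrier (tensor_alg m0 n)"
    moreover from this have "act a \<phi> = (\<lambda>v. 0)" for \<phi> by auto
    ultimately show "x \<otimes>\<^bsub>tensor_alg m0 n\<^esub> a \<in> ?J" "a \<otimes>\<^bsub>tensor_alg m0 n\<^esub> x \<in> ?J"
      by (auto simp: tensor_closed act_mult act_fun_zero)
  qed
  moreover have "env_relations m0 n \<subseteq> ?J"
    using env_relations_subset act_env_relation by (fastforce simp: env_relations_def)
  ultimately have "(env_ideal m0 n) \<subseteq> ?J" unfolding env_ideal_def by (rule genideal_minimal)
  then show "f \<in> env_ideal m0 n \<Longrightarrow> act f \<phi> v = 0" by blast
qed

lemma Ugl_ring: "ring (Ugl m0 n)"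
  unfolding Ugl_def by (rule ideal.quotient_is_ring[OF ideal_env])

lemma env_class_hom: "env_class m0 n \<in> ring_hom (tensor_alg m0 n) (Ugl m0 n)"
  unfolding Ugl_def env_class_def by (rule ideal.rcos_ring_hom[OF ideal_env])

lemma env_class_simps:
  "f \<in> carrier (tensor_alg m0 n) \<Longrightarrow> env_class m0 n f \<in> carrier (Ugl m0 n)"
  "f \<in> carrier (tensor_alg m0 n) \<Longrightarrow> g \<in> carrier (tensor_alg m0 n) \<Longrightarrow>
    env_class m0 n (f + g) = env_class m0 n f \<oplus>\<^bsub>Ugl m0 n\<^esub> env_class m0 n g"
  "f \<in> carrier (tensor_alg m0 n) \<Longrightarrow> g \<in> carrier (tensor_alg m0 n) \<Longrightarrow>
    env_class m0 n (f * g) = env_class m0 n f \<otimes>\<^bsub>Ugl m0 n\<^esub> env_class m0 n g"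
  "env_class m0 n 1 = \<one>\<^bsub>Ugl m0 n\<^esub>"
  using ring_hom_closed[OF env_class_hom, of f] ring_hom_add[OF env_class_hom, of f g] ring_hom_mult[OF env_class_hom, of f g]
    ring_hom_one[OF env_class_hom] by simp_all

lemma env_class_zero: "env_class m0 n 0 = \<zero>\<^bsub>Ugl m0 n\<^esub>"
  using ring_hom_zero[OF env_class_hom tensor_alg_ring Ugl_ring] by simp

lemma env_class_uminus: "f \<in> carrier (tensor_alg m0 n) \<Longrightarrow> env_class m0 n (- f) = \<ominus>\<^bsub>Ugl m0 n\<^esub> env_class m0 n f"
proof -
  interpret ring "Ugl m0 n" by (rule Ugl_ring)
  assume f: "f \<in> carrier (tensor_alg m0 n)"
  then have "env_class m0 n (- f) \<oplus>\<^bsub>Ugl m0 n\<^esub> env_class m0 n f = \<zero>\<^bsub>Ugl m0 n\<^esub>"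
    using env_class_simps(2)[of "- f" f] by (simp add: tensor_closed env_class_zero)
  then show ?thesis using f by (intro minus_equality[symmetric]) (auto intro: env_class_simps tensor_closed)
qed

lemma env_class_diff:
  "f \<in> carrier (tensor_alg m0 n) \<Longrightarrow> g \<in> carrier (tensor_alg m0 n) \<Longrightarrow>
    env_class m0 n (f - g) = env_class m0 n f \<ominus>\<^bsub>Ugl m0 n\<^esub> env_class m0 n g"
  using env_class_simps(2)[of f "- g"] by (simp add: tensor_closed env_class_uminus a_minus_def)

lemma carrier_Ugl: "carrier (Ugl m0 n) = env_class m0 n ` carrier (tensor_alg m0 n)"
  by (auto simp: Ugl_def FactRing_def A_RCOSETS_def' env_class_def)

lemma env_class_eq_iff:
  "f \<in> carrier (tensor_alg m0 n) \<Longrightarrow> g \<in> carrier (tensor_alg m0 n) \<Longrightarrow>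
    env_class m0 n f = env_class m0 n g \<longleftrightarrow> f - g \<in> env_ideal m0 n"
proof -
  interpret ideal "env_ideal m0 n" "tensor_alg m0 n" by (rule ideal_env)
  assume fg: "f \<in> carrier (tensor_alg m0 n)" "g \<in> carrier (tensor_alg m0 n)"
  have "f \<ominus>\<^bsub>tensor_alg m0 n\<^esub> g = f - g"
    using tensor_a_inv[OF fg(2)] by (simp add: a_minus_def)
  then show ?thesis
    using quotient_eq_iff_same_a_r_cos[OF ideal_env fg] unfolding env_class_def by simp
qed

end

section \<open>Irregular products kill words without virtual letters\<close>

lemma gen_act_eq_zero:
  assumes "\<And>u. count_list u g + of_bool (b = g) = count_list v g + of_bool (a = g) \<Longrightarrow> \<phi> u = 0"
  shows "gen_act a b \<phi> v = 0"
  using assms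
proof (induction v arbitrary: \<phi>)
  case (Cons x v)
  have "gen_act a b (\<lambda>u. \<phi> (x # u)) v = 0"
    by (rule Cons.IH) (rule Cons.prems, simp)
  moreover have "\<phi> (a # v) = 0" if "x = b"
    using that by (intro Cons.prems) auto
  ultimately show ?case by simp
qed simp

lemma gen_act_notin: "b \<notin> set v \<Longrightarrow> gen_act a b \<phi> v = 0"
  by (induction v arbitrary: \<phi>) auto

text \<open>
  The list \<open>r\<close> holds the factors in the order in which they act on \<open>v\<close>. The premise says that the first \<open>i\<close>
  factors consume \<open>g\<close> more often than it occurs in \<open>v\<close> and is produced before. Induction on \<open>r\<close>: the first
  factor changes the number of letters \<open>g\<close> in \<open>v\<close> in a way that preserves this excess.
\<close>

lemma word_act_irregular:
  assumes "i \<in> {1..length r}"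
    and "count_list (map snd (take i r)) g > count_list v g + count_list (map fst (take (i - 1) r)) g"
  shows "word_act (rev r) \<phi> v = 0"
  using assms
proof (induction r arbitrary: i v)
  case (Cons p r)
  obtain a b where p: "p = (a, b)" by force
  obtain j where j: "i = Suc j" using Cons.prems(1) by (cases i) auto
  show ?case
  proof (cases "b = g \<and> g \<notin> set v")
    case True
    then show ?thesis by (simp add: p gen_act_notin)
  next
    case False
    have "gen_act a b (word_act (rev r) \<phi>) v = 0"
    proof (rule gen_act_eq_zero)
      fix u assume u: "count_list u g + of_bool (b = g) = count_list v g + of_bool (a = g)"
      have "j \<noteq> 0"
      proof
        assume "j = 0"
        with Cons.prems(2) have "of_bool (b = g) > count_list v g" by (simp add: p j split: if_splits)
        then show False using False by (cases "b = g") (auto simp: count_list_0_iff)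
      qed
      then obtain k where k: "j = Suc k" by (cases j) auto
      have "of_bool (b = g) + count_list (map snd (take j r)) g
          > count_list v g + of_bool (a = g) + count_list (map fst (take (j - 1) r)) g"
        using Cons.prems(2) by (auto simp: p j k split: if_splits)
      then show "word_act (rev r) \<phi> u = 0"
        using Cons.prems(1) u k j by (intro Cons.IH[of j]) auto
    qed
    then show ?thesis by (simp add: p)
  qed
qed simp

lemma left_ideal_gen_left_ideal:
  assumes "ring R" "S \<subseteq> carrier R"
  shows "left_ideal (gen_left_ideal R S) R" "S \<subseteq> gen_left_ideal R S"
proof -
  interpret ring R by fact
  let ?L = "{I. left_ideal I R \<and> S \<subseteq> I}"
  have "subgroup (carrier R) (add_monoid R)" by (rule add.subgroup_self)
  then have ne: "carrier R \<in> ?L"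
    using assms(2) by (simp add: left_ideal_def additive_subgroup_def)
  have "subgroup (\<Inter>?L) (add_monoid R)"
    using ne by (intro add.subgroups_Inter) (auto simp: left_ideal_def additive_subgroup_def)
  then show "left_ideal (gen_left_ideal R S) R"
    unfolding gen_left_ideal_def left_ideal_def[of "\<Inter>?L"]
    by (auto simp: additive_subgroup_def left_ideal_def)
  show "S \<subseteq> gen_left_ideal R S" by (auto simp: gen_left_ideal_def)
qed

context
  fixes m0 n :: nat
begin

lemma gen_prod_env_class:
  "set w \<subseteq> symbols m0 n \<times> symbols m0 n \<Longrightarrow> gen_prod m0 n w = env_class m0 n (Poly_Mapping.single w 1)"
proof (induction w)
  case Nil
  have "Poly_Mapping.single [] 1 = (1 :: free_elt)" by (metis single_one zero_list_def)
  then show ?case by (simp add: gen_prod_def env_class_simps(4))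
next
  case (Cons p w)
  then obtain a b where p: "p = (a, b)" "a \<in> symbols m0 n" "b \<in> symbols m0 n" by auto
  have "Poly_Mapping.single (p # w) 1 = E a b * Poly_Mapping.single w (1::complex)"
    by (simp add: E_def mult_single plus_list_def p)
  then show ?case
    using Cons p by (simp add: gen_prod_def gen_def env_class_simps(3) E_in_tensor single_in_tensor)
qed

lemma irregular_products_subset:
  "{gen_prod m0 n w | w. set w \<subseteq> symbols m0 n \<times> symbols m0 n \<and> irregular m0 w} \<subseteq> carrier (Ugl m0 n)"
  by (auto simp: gen_prod_env_class intro!: env_class_simps(1) single_in_tensor)

lemma left_ideal_Irr: "left_ideal (Irr m0 n) (Ugl m0 n)"
  unfolding Irr_def by (rule left_ideal_gen_left_ideal[OF Ugl_ring irregular_products_subset])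

lemma irregular_in_Irr:
  "set w \<subseteq> symbols m0 n \<times> symbols m0 n \<Longrightarrow> irregular m0 w \<Longrightarrow> gen_prod m0 n w \<in> Irr m0 n"
  unfolding Irr_def using left_ideal_gen_left_ideal(2)[OF Ugl_ring irregular_products_subset] by blast

text \<open>
  The elements that kill all words without virtual letters form a left ideal, which contains the irregular products by
  lemma \<open>word_act_irregular\<close>.
\<close>

lemma act_Irr:
  assumes "f \<in> carrier (tensor_alg m0 n)" "env_class m0 n f \<in> Irr m0 n" "set v \<inter> virtuals m0 = {}"
  shows "act f \<phi> v = 0"
proof -
  interpret U: ring "Ugl m0 n" by (rule Ugl_ring)
  let ?T = "tensor_alg m0 n" and ?cl = "env_class m0 n"
  define K where "K = {f \<in> carrier ?T. \<forall>\<phi> v. set v \<inter> virtuals m0 = {} \<longrightarrow> act f \<phi> v = 0}"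
  have "left_ideal (?cl ` K) (Ugl m0 n)"
    unfolding left_ideal_def additive_subgroup_def
  proof (intro conjI ballI)
    show "subgroup (?cl ` K) (add_monoid (Ugl m0 n))"
    proof (rule U.add.subgroupI)
      show "?cl ` K \<subseteq> carrier (Ugl m0 n)" by (auto simp: K_def intro: env_class_simps)
      have "0 \<in> K" by (simp add: K_def tensor_closed)
      then show "?cl ` K \<noteq> {}" by auto
    next
      fix x assume "x \<in> ?cl ` K"
      then obtain f where f: "f \<in> K" "x = ?cl f" by auto
      then have "- f \<in> K" by (auto simp: K_def tensor_closed act_uminus)
      then show "\<ominus>\<^bsub>Ugl m0 n\<^esub> x \<in> ?cl ` K"
        using f by (auto simp: K_def env_class_uminus[symmetric])
    next
      fix x y assume "x \<in> ?cl ` K" "y \<in> ?cl ` K"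
      then obtain f g where f: "f \<in> K" "x = ?cl f" and g: "g \<in> K" "y = ?cl g" by auto
      then have "f + g \<in> K" by (auto simp: K_def tensor_closed act_add)
      then show "x \<oplus>\<^bsub>Ugl m0 n\<^esub> y \<in> ?cl ` K"
        using f g by (auto simp: K_def env_class_simps(2)[symmetric])
    qed
  next
    fix a x assume "a \<in> ?cl ` K" "x \<in> carrier (Ugl m0 n)"
    then obtain f g where f: "f \<in> K" "a = ?cl f" and g: "g \<in> carrier ?T" "x = ?cl g"
      by (auto simp: carrier_Ugl)
    then have "g * f \<in> K" by (auto simp: K_def tensor_closed act_mult)
    then show "x \<otimes>\<^bsub>Ugl m0 n\<^esub> a \<in> ?cl ` K"
      using f g by (auto simp: K_def env_class_simps(3)[symmetric])
  qed
  moreover have "{gen_prod m0 n w | w. set w \<subseteq> symbols m0 n \<times> symbols m0 n \<and> irregular m0 w} \<subseteq> ?cl ` K"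
  proof clarify
    fix w assume w: "set w \<subseteq> symbols m0 n \<times> symbols m0 n" "irregular m0 w"
    have "word_act w \<phi> v = 0" if v: "set v \<inter> virtuals m0 = {}" for \<phi> v
    proof -
      obtain i g where "i \<in> {1..length w}" "g \<in> virtuals m0"
        and gt: "count_list (map snd (take i (rev w))) g > count_list (map fst (take (i - 1) (rev w))) g"
        using w(2) by (auto simp: irregular_def)
      moreover from this v have "count_list v g = 0" by (auto simp: count_list_0_iff)
      ultimately show ?thesis using word_act_irregular[of i "rev w" v g \<phi>] by simp
    qed
    then have "Poly_Mapping.single w 1 \<in> K"
      using w by (simp add: K_def single_in_tensor act_single)
    then show "gen_prod m0 n w \<in> ?cl ` K" using w by (simp add: gen_prod_env_class)
  qed
  ultimately have "Irr m0 n \<subseteq> ?cl ` K"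
    unfolding Irr_def gen_left_ideal_def by blast
  then obtain g where g: "g \<in> K" "?cl f = ?cl g" using assms(2) by auto
  then have "f - g \<in> env_ideal m0 n" using assms(1) by (simp add: env_class_eq_iff K_def)
  then have "act (f - g) \<phi> v = 0" by (rule act_env_ideal)
  then show ?thesis using g(1) assms(3) by (simp add: act_diff K_def)
qed

end

section \<open>Reading off leading coefficients\<close>

fun pure_tensor :: "('b \<Rightarrow> complex) \<Rightarrow> ('b list \<Rightarrow> complex) \<Rightarrow> 'b list \<Rightarrow> complex" where
  "pure_tensor c \<phi> [] = 0"
| "pure_tensor c \<phi> (x # v) = c x * \<phi> v"

text \<open>
  The virtual symbols in use start at \<open>1\<close>, hence the symbol number \<open>0\<close> is an additional even letter that no
  generator of \<open>gl(m\<^sub>0|n)\<close> touches.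
\<close>

abbreviation trivial_letter :: symbol where "trivial_letter \<equiv> Virtual 0"

text \<open>
  For a list \<open>P\<close> of pairs \<open>(i\<^sub>k, j\<^sub>k)\<close>, let \<open>z\<close> be the trivial letter. The covector is the tensor product of the
  \<open>i\<^sub>k* - \<delta>\<^bsub>i\<^sub>k,j\<^sub>k\<^esub> z*\<close>, and evaluation takes place at the tensor product of the \<open>j\<^sub>k + z\<close>. These are chosen such
  that the matrix coefficient of the identity vanishes at each position while that of \<open>e\<^bsub>a,b\<^esub>\<close> is \<open>1\<close> for
  \<open>(a, b) = (i\<^sub>k, j\<^sub>k)\<close> and \<open>0\<close> otherwise. A product of generators has a nonzero coefficient
  only if it hits every position, so products with fewer factors than \<open>P\<close> are invisible, and those with as
  many are seen only if they agree with \<open>P\<close> up to the order.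
\<close>

fun covector :: "(symbol \<times> symbol) list \<Rightarrow> symbol list \<Rightarrow> complex" where
  "covector [] = (\<lambda>v. of_bool (v = []))"
| "covector ((i, j) # P) = pure_tensor (\<lambda>x. of_bool (x = i) - of_bool (i = j \<and> x = trivial_letter)) (covector P)"

fun evaluate :: "(symbol \<times> symbol) list \<Rightarrow> (symbol list \<Rightarrow> complex) \<Rightarrow> complex" where
  "evaluate [] \<phi> = \<phi> []"
| "evaluate ((i, j) # P) \<phi> = evaluate P (\<lambda>v. \<phi> (j # v)) + evaluate P (\<lambda>v. \<phi> (trivial_letter # v))"

definition pairing :: "(symbol \<times> symbol) list \<Rightarrow> (symbol \<times> symbol) list \<Rightarrow> complex" where
  "pairing w P = evaluate P (word_act w (covector P))"

lemma evaluate_add: "evaluate P (\<lambda>v. \<phi> v + \<psi> v) = evaluate P \<phi> + evaluate P \<psi>"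
proof (induction P arbitrary: \<phi> \<psi>)
  case (Cons p P)
  then show ?case by (cases p) (simp only: evaluate.simps, simp only: add_ac)
qed simp

lemma evaluate_scale: "evaluate P (\<lambda>v. c * \<phi> v) = c * evaluate P \<phi>"
  by (induction P \<phi> rule: evaluate.induct) (simp_all add: algebra_simps)

lemma evaluate_sum: "evaluate P (\<lambda>v. \<Sum>i\<in>B. \<phi> i v) = (\<Sum>i\<in>B. evaluate P (\<phi> i))"
proof (induction B rule: infinite_finite_induct)
  case (insert i B)
  then show ?case by (simp add: evaluate_add)
qed (use evaluate_scale[of P 0 "\<lambda>_. 0"] in simp_all)

lemma evaluate_zero:
  assumes "\<And>v. set v \<subseteq> insert trivial_letter (snd ` set P) \<Longrightarrow> \<phi> v = 0"
  shows "evaluate P \<phi> = 0"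
  using assms
proof (induction P \<phi> rule: evaluate.induct)
  case (2 i j P \<phi>)
  have "evaluate P (\<lambda>v. \<phi> (j # v)) = 0"
    by (rule 2) (intro 2(3), auto)
  moreover have "evaluate P (\<lambda>v. \<phi> (trivial_letter # v)) = 0"
    by (rule 2) (intro 2(3), auto)
  ultimately show ?case by simp
qed simp

lemma evaluate_pure_tensor:
  "evaluate ((i, j) # P) (pure_tensor c \<phi>) = (c j + c trivial_letter) * evaluate P \<phi>"
  by (simp add: evaluate_scale distrib_right)

definition proper_pairs :: "(symbol \<times> symbol) set" where
  "proper_pairs = range Proper \<times> range Proper"

lemma gen_act_pure_tensor:
  assumes "(a, b) \<in> proper_pairs"
  shows "gen_act a b (pure_tensor c \<phi>) = (\<lambda>v. pure_tensor (\<lambda>x. of_bool (x = b) * c a) \<phi> v + pure_tensor c (gen_act a b \<phi>) v)"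
proof
  fix v
  have "(-1 :: complex) ^ ((parity a + parity b) * k) = 1" for k
    using assms by (auto simp: proper_pairs_def)
  then show "gen_act a b (pure_tensor c \<phi>) v = pure_tensor (\<lambda>x. of_bool (x = b) * c a) \<phi> v + pure_tensor c (gen_act a b \<phi>) v"
    by (cases v) (simp_all add: gen_act_scale)
qed

text \<open>
  The sum over all factors of \<open>w\<close> of the coefficient for that factor acting at a first position with vector
  \<open>j\<close> and covector \<open>c\<close>, times the pairing of the other factors with the remaining positions \<open>P\<close>. The list \<open>u\<close>
  holds the factors already passed.
\<close>

fun removals :: "symbol \<Rightarrow> (symbol \<times> symbol) list \<Rightarrow> (symbol \<Rightarrow> complex) \<Rightarrow>
    (symbol \<times> symbol) list \<Rightarrow> (symbol \<times> symbol) list \<Rightarrow> complex" where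
  "removals j P c u [] = 0"
| "removals j P c u ((a, b) # w) = of_bool (b = j) * c a * pairing (u @ w) P + removals j P c (u @ [(a, b)]) w"

text \<open>
  The product of the factorials of the multiplicities: the number of ways to match the list with a
  rearrangement of itself.
\<close>

fun multiplicities :: "'b list \<Rightarrow> nat" where
  "multiplicities [] = 1"
| "multiplicities (p # P) = count (mset (p # P)) p * multiplicities P"

lemma multiplicities_pos: "multiplicities P > 0"
  by (induction P) auto

lemma removals_count:
  assumes "\<And>w'. Suc (length w') = length (u @ w) \<Longrightarrow> set w' \<subseteq> set (u @ w) \<Longrightarrow>
      pairing w' P = of_bool (mset w' = mset P) * N"
    and "(\<And>a. a \<in> fst ` set w \<Longrightarrow> c a = of_bool (a = i))"
  shows "removals j P c u w = of_nat (count (mset w) (i, j)) * of_bool (mset (u @ w) = add_mset (i, j) (mset P)) * N"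
  using assms
proof (induction w arbitrary: u)
  case (Cons p w)
  obtain a b where p: "p = (a, b)" by force
  have 1: "removals j P c (u @ [p]) w = of_nat (count (mset w) (i, j)) * of_bool (mset ((u @ [p]) @ w) = add_mset (i, j) (mset P)) * N"
  proof (rule Cons.IH)
    fix w' assume "Suc (length w') = length ((u @ [p]) @ w)" "set w' \<subseteq> set ((u @ [p]) @ w)"
    then show "pairing w' P = of_bool (mset w' = mset P) * N" by (intro Cons.prems(1)) auto
  qed (use Cons.prems(2) in auto)
  have 2: "pairing (u @ w) P = of_bool (mset (u @ w) = mset P) * N"
    by (rule Cons.prems(1)) auto
  have 3: "c a = of_bool (a = i)" using Cons.prems(2) by (simp add: p)
  show ?case
    unfolding p removals.simps using 1 2 3 by (auto simp: p algebra_simps)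
qed simp

text \<open>
  Coproduct rule for the first position: each factor acts either there or on the rest. If two factors act
  at the first position, too few remain for the rest and the term vanishes by \<open>van\<close>.
\<close>

lemma evaluate_word_act_pure_tensor:
  assumes van: "\<And>w'. length w' < length P \<Longrightarrow> set w' \<subseteq> proper_pairs \<Longrightarrow> pairing w' P = 0"
    and "length u + length w \<le> Suc (length P)" "set u \<subseteq> proper_pairs" "set w \<subseteq> proper_pairs"
  shows "evaluate ((i, j) # P) (word_act w (pure_tensor c (word_act u (covector P))))
    = (c j + c trivial_letter) * pairing (u @ w) P + removals j P c u w"
  using assms(2-4)
proof (induction w arbitrary: u c)
  case Nil
  then show ?case by (simp only: word_act_simps evaluate_pure_tensor) (simp add: pairing_def)
next
  case (Cons p w)
  obtain a b where p: "p = (a, b)" by force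
  have ab: "(a, b) \<in> proper_pairs" using Cons.prems p by auto
  then have b: "b \<noteq> trivial_letter" by (auto simp: proper_pairs_def)
  let ?c = "\<lambda>x. of_bool (x = b) * c a"
  have zero: "removals j P c' u w = 0" if "length u + length w \<le> length P" "set u \<subseteq> proper_pairs"
      "set w \<subseteq> proper_pairs" for c' and u w :: "(symbol \<times> symbol) list"
    using that
  proof (induction w arbitrary: u)
    case (Cons q w)
    have "pairing (u @ w) P = 0" by (rule van) (use Cons.prems in auto)
    moreover have "removals j P c' (u @ [q]) w = 0" by (rule Cons.IH) (use Cons.prems in auto)
    ultimately show ?case by (cases q) simp
  qed simp
  have "evaluate ((i, j) # P) (word_act (p # w) (pure_tensor c (word_act u (covector P))))
     = evaluate ((i, j) # P) (word_act w (pure_tensor ?c (word_act u (covector P))))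
     + evaluate ((i, j) # P) (word_act w (pure_tensor c (word_act (u @ [p]) (covector P))))"
    by (simp only: p word_act_simps gen_act_pure_tensor[OF ab] word_act_add evaluate_add)
  also have "evaluate ((i, j) # P) (word_act w (pure_tensor ?c (word_act u (covector P))))
      = (?c j + ?c trivial_letter) * pairing (u @ w) P + removals j P ?c u w"
    by (rule Cons.IH) (use Cons.prems in auto)
  also have "removals j P ?c u w = 0" by (rule zero) (use Cons.prems in auto)
  also have "evaluate ((i, j) # P) (word_act w (pure_tensor c (word_act (u @ [p]) (covector P))))
      = (c j + c trivial_letter) * pairing ((u @ [p]) @ w) P + removals j P c (u @ [p]) w"
    by (rule Cons.IH) (use Cons.prems in auto)
  finally show ?case using b by (auto simp: p algebra_simps)
qed

lemma pairing_eq: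
  assumes "set w \<subseteq> proper_pairs" "set P \<subseteq> proper_pairs" "length w \<le> length P"
  shows "pairing w P = of_bool (mset w = mset P) * of_nat (multiplicities P)"
  using assms
proof (induction P arbitrary: w)
  case Nil
  then show ?case by (simp add: pairing_def)
next
  case (Cons p P)
  obtain i j where p: "p = (i, j)" by force
  have ij: "(i, j) \<in> proper_pairs" using Cons.prems p by auto
  let ?c = "\<lambda>x. of_bool (x = i) - of_bool (i = j \<and> x = trivial_letter) :: complex"
  have IH: "pairing w' P = of_bool (mset w' = mset P) * of_nat (multiplicities P)"
    if "set w' \<subseteq> proper_pairs" "length w' \<le> length P" for w'
    using Cons that by auto
  have van: "pairing w' P = 0" if "length w' < length P" "set w' \<subseteq> proper_pairs" for w'
  proof -
    have "mset w' \<noteq> mset P" using that(1) by (metis nat_less_le size_mset)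
    then show ?thesis using IH[of w'] that by simp
  qed
  have "pairing w (p # P) = evaluate ((i, j) # P) (word_act w (pure_tensor ?c (word_act [] (covector P))))"
    by (simp add: pairing_def p)
  also have "\<dots> = (?c j + ?c trivial_letter) * pairing ([] @ w) P + removals j P ?c [] w"
    using Cons.prems by (intro evaluate_word_act_pure_tensor van) auto
  also have "?c j + ?c trivial_letter = 0"
    using ij by (auto simp: proper_pairs_def)
  also have "removals j P ?c [] w = of_nat (count (mset w) (i, j))
      * of_bool (mset ([] @ w) = add_mset (i, j) (mset P)) * of_nat (multiplicities P)"
  proof (rule removals_count)
    fix w' assume "Suc (length w') = length ([] @ w)" "set w' \<subseteq> set ([] @ w)"
    then show "pairing w' P = of_bool (mset w' = mset P) * of_nat (multiplicities P)"
      using Cons.prems by (intro IH) auto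
  next
    fix a assume "a \<in> fst ` set w"
    then have "a \<noteq> trivial_letter" using Cons.prems by (auto simp: proper_pairs_def)
    then show "?c a = of_bool (a = i)" by simp
  qed
  finally show ?case by (auto simp: p distrib_right)
qed

section \<open>The proper part meets the irregular ideal in zero\<close>

context
  fixes m0 n :: nat
begin

abbreviation "PP \<equiv> propers n \<times> propers n"

definition short :: "nat \<Rightarrow> free_elt set" where
  "short d = {f. \<forall>w\<in>Poly_Mapping.keys f. set w \<subseteq> PP \<and> length w < d}"

text \<open>
  Congruent, modulo the relations, to a combination of proper words with fewer than \<open>d\<close> letters. Words of
  \<open>d\<close> letters can be reordered up to such elements (lemma \<open>mon_permute\<close>).
\<close>

definition reducible :: "nat \<Rightarrow> free_elt set" where
  "reducible d = {f. \<exists>g\<in>short d. f - g \<in> env_ideal m0 n}"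

lemma PP_subset: "PP \<subseteq> symbols m0 n \<times> symbols m0 n" "PP \<subseteq> proper_pairs"
  by (auto simp: symbols_def propers_def proper_pairs_def)

lemma keys_PP_in_tensor:
  "\<forall>w\<in>Poly_Mapping.keys f. set w \<subseteq> PP \<Longrightarrow> f \<in> carrier (tensor_alg m0 n)"
  using PP_subset(1) by (simp add: tensor_alg_def) (meson order_trans)

lemma short_in_tensor: "f \<in> short d \<Longrightarrow> f \<in> carrier (tensor_alg m0 n)"
  by (rule keys_PP_in_tensor) (simp add: short_def)

lemma short_zero: "0 \<in> short d"
  by (simp add: short_def)

lemma short_add: "f \<in> short d \<Longrightarrow> g \<in> short d \<Longrightarrow> f + g \<in> short d"
  using Poly_Mapping.keys_add[of f g] by (auto simp: short_def)

lemma short_uminus: "f \<in> short d \<Longrightarrow> - f \<in> short d"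
  by (auto simp: short_def in_keys_iff)

lemma short_single: "set w \<subseteq> PP \<Longrightarrow> length w < d \<Longrightarrow> Poly_Mapping.single w c \<in> short d"
  by (simp add: short_def)

lemma short_scale: "f \<in> short d \<Longrightarrow> Poly_Mapping.single [] c * f \<in> short d"
proof -
  assume "f \<in> short d"
  moreover have "Poly_Mapping.keys (Poly_Mapping.single [] c * f) \<subseteq> Poly_Mapping.keys f"
  proof
    fix w assume "w \<in> Poly_Mapping.keys (Poly_Mapping.single [] c * f)"
    then obtain a b where "a \<in> Poly_Mapping.keys (Poly_Mapping.single [] c :: free_elt)"
        "b \<in> Poly_Mapping.keys f" "w = a + b"
      using keys_mult[of "Poly_Mapping.single [] c" f] by blast
    then show "w \<in> Poly_Mapping.keys f" by (simp add: plus_list_def split: if_splits)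
  qed
  ultimately show ?thesis by (auto simp: short_def)
qed

lemma short_sum: "(\<And>i. i \<in> B \<Longrightarrow> f i \<in> short d) \<Longrightarrow> sum f B \<in> short d"
  by (induction B rule: infinite_finite_induct) (auto intro: short_zero short_add)

lemma reducible_short: "f \<in> short d \<Longrightarrow> f \<in> reducible d"
  using env_ideal_closed(1) by (force simp: reducible_def)

lemma reducible_ideal: "f \<in> env_ideal m0 n \<Longrightarrow> f \<in> reducible d"
  using short_zero by (force simp: reducible_def)

lemma reducible_add: "f \<in> reducible d \<Longrightarrow> g \<in> reducible d \<Longrightarrow> f + g \<in> reducible d"
proof -
  assume "f \<in> reducible d" "g \<in> reducible d"
  then obtain f' g' where "f' \<in> short d" "g' \<in> short d" "f - f' \<in> env_ideal m0 n" "g - g' \<in> env_ideal m0 n"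
    by (auto simp: reducible_def)
  then show ?thesis
    unfolding reducible_def
    by (intro CollectI bexI[of _ "f' + g'"]) (simp_all add: add_diff_add env_ideal_closed(2) short_add)
qed

lemma reducible_sum: "(\<And>i. i \<in> B \<Longrightarrow> f i \<in> reducible d) \<Longrightarrow> sum f B \<in> reducible d"
  by (induction B rule: infinite_finite_induct) (auto intro: reducible_short short_zero reducible_add)

lemma reducible_scale: "f \<in> reducible d \<Longrightarrow> Poly_Mapping.single [] c * f \<in> reducible d"
proof -
  assume "f \<in> reducible d"
  then obtain g where g: "g \<in> short d" "f - g \<in> env_ideal m0 n" by (auto simp: reducible_def)
  have "Poly_Mapping.single [] c \<in> carrier (tensor_alg m0 n)" by (rule single_in_tensor) simp
  from env_ideal_closed(4)[OF g(2) this] show ?thesis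
    unfolding reducible_def using short_scale[OF g(1), of c]
    by (intro CollectI bexI[of _ "Poly_Mapping.single [] c * g"]) (auto simp: right_diff_distrib)
qed

abbreviation mon :: "(symbol \<times> symbol) list \<Rightarrow> free_elt" where
  "mon w \<equiv> Poly_Mapping.single w 1"

lemma mon_mult: "mon u * mon w = mon (u @ w)"
  by (simp add: mult_single plus_list_def)

lemma mon_swap:
  assumes "set (u @ p # q # w) \<subseteq> PP" "length (u @ p # q # w) \<le> d"
  shows "mon (u @ p # q # w) - mon (u @ q # p # w) \<in> reducible d"
proof -
  obtain a b c e where pq: "p = (a, b)" "q = (c, e)" by (cases p; cases q)
  have sym: "{a, b, c, e} \<subseteq> symbols m0 n"
    and par: "parity a = 1" "parity b = 1" "parity c = 1" "parity e = 1"
    using assms(1) by (auto simp: pq propers_def symbols_def)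
  have uw: "mon u \<in> carrier (tensor_alg m0 n)" "mon w \<in> carrier (tensor_alg m0 n)"
    using assms(1) PP_subset(1) by (auto intro!: single_in_tensor)
  have "E a b * E c e - E c e * E a b - superbracket a b c e \<in> env_ideal m0 n"
    using env_ideal_relation[OF sym] by (simp add: par)
  then have "mon u * (E a b * E c e - E c e * E a b - superbracket a b c e) * mon w \<in> env_ideal m0 n"
    using uw by (intro env_ideal_closed(3)[OF env_ideal_closed(4)])
  then have "mon u * (E a b * E c e - E c e * E a b - superbracket a b c e) * mon w \<in> reducible d"
    by (rule reducible_ideal)
  moreover have "mon u * superbracket a b c e * mon w \<in> short d"
  proof -
    have "mon u * superbracket a b c e * mon w
        = (if b = c then mon (u @ (a, e) # w) else 0) - (if a = e then mon (u @ (c, b) # w) else 0)"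
      by (simp add: superbracket_def E_def par right_diff_distrib left_diff_distrib mon_mult)
    also have "\<dots> = (if b = c then mon (u @ (a, e) # w) else 0) + - (if a = e then mon (u @ (c, b) # w) else 0)"
      by simp
    also have "\<dots> \<in> short d"
      using assms by (intro short_add short_uminus) (auto simp: pq intro!: short_zero short_single)
    finally show ?thesis .
  qed
  moreover have "mon (u @ p # q # w) - mon (u @ q # p # w)
      = mon u * (E a b * E c e - E c e * E a b - superbracket a b c e) * mon w + mon u * superbracket a b c e * mon w"
    by (simp add: E_def pq right_diff_distrib left_diff_distrib mon_mult)
  ultimately show ?thesis by (auto intro: reducible_add reducible_short)
qed

lemma mon_move:
  assumes "set (u @ x @ p # w) \<subseteq> PP" "length (u @ x @ p # w) \<le> d"
  shows "mon (u @ x @ p # w) - mon (u @ p # x @ w) \<in> reducible d"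
  using assms
proof (induction x arbitrary: w rule: rev_induct)
  case Nil
  then show ?case by (simp add: reducible_short short_zero)
next
  case (snoc q x)
  have "mon ((u @ x) @ q # p # w) - mon ((u @ x) @ p # q # w) \<in> reducible d"
    using snoc.prems by (intro mon_swap) auto
  moreover have "mon (u @ x @ p # q # w) - mon (u @ p # x @ q # w) \<in> reducible d"
    using snoc.prems by (intro snoc.IH) auto
  ultimately show ?case using reducible_add by fastforce
qed

lemma mon_permute:
  assumes "mset w = mset w'" "set (u @ w) \<subseteq> PP" "length (u @ w) \<le> d"
  shows "mon (u @ w) - mon (u @ w') \<in> reducible d"
  using assms
proof (induction w arbitrary: u w')
  case Nil
  then show ?case by (simp add: reducible_short short_zero)
next
  case (Cons p w)
  then have "p \<in> set w'" by (metis list.set_intros(1) set_mset_mset)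
  then obtain x y where w': "w' = x @ p # y" by (meson split_list)
  have eq: "mset w = mset (x @ y)" using Cons.prems(1) by (simp add: w')
  then have s: "set w = set (x @ y)" "length w = length (x @ y)"
    by (metis set_mset_mset, metis size_mset)
  have "mon ((u @ [p]) @ w) - mon ((u @ [p]) @ x @ y) \<in> reducible d"
    using Cons.prems eq by (intro Cons.IH) auto
  moreover have "mon (u @ x @ p # y) - mon (u @ p # x @ y) \<in> reducible d"
    using Cons.prems s by (intro mon_move) auto
  then have "Poly_Mapping.single [] (-1) * (mon (u @ x @ p # y) - mon (u @ p # x @ y)) \<in> reducible d"
    by (rule reducible_scale)
  moreover have "Poly_Mapping.single [] (-1) * f = - f" for f :: free_elt
    by (metis mult_minus1 single_one single_uminus zero_list_def)
  ultimately have "(mon ((u @ [p]) @ w) - mon ((u @ [p]) @ x @ y))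
      + - (mon (u @ x @ p # y) - mon (u @ p # x @ y)) \<in> reducible d"
    by (intro reducible_add) simp_all
  then show ?case by (simp add: w')
qed

text \<open>
  Descent on the length. The pairing shows that the coefficients of the longest words add up to zero over
  each class of rearrangements. Reordering all words of a class into the same word, the longest
  words cancel, and an element with shorter words remains that acts in the same way.
\<close>

lemma faithful:
  assumes "f \<in> short d" "\<And>\<phi> v. set v \<inter> virtuals m0 = {} \<Longrightarrow> act f \<phi> v = 0"
  shows "f \<in> env_ideal m0 n"
  using assms
proof (induction d arbitrary: f)
  case 0
  then have "f = 0" by (auto simp: short_def intro!: poly_mapping_eqI simp: in_keys_iff)
  then show ?case by (simp add: env_ideal_closed)
next
  case (Suc d)
  let ?l = "poly_mapping.lookup f"
  define B where "B = {w \<in> Poly_Mapping.keys f. length w = d}"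
  define C where "C = {w \<in> Poly_Mapping.keys f. length w < d}"
  have fin: "finite B" "finite C" by (simp_all add: B_def C_def)
  have keys: "Poly_Mapping.keys f = B \<union> C" "B \<inter> C = {}"
    using Suc.prems(1) by (force simp: B_def C_def short_def)+
  have PP: "set w \<subseteq> PP" if "w \<in> Poly_Mapping.keys f" for w
    using Suc.prems(1) that by (simp add: short_def)
  have orbit: "(\<Sum>w\<in>{w \<in> B. mset w = mset P}. ?l w) = 0" if "P \<in> B" for P
  proof -
    have P: "set P \<subseteq> PP" "length P = d" "P \<in> Poly_Mapping.keys f" using PP that by (auto simp: B_def)
    have "evaluate P (act f (covector P)) = 0"
    proof (rule evaluate_zero)
      fix v assume "set v \<subseteq> insert trivial_letter (snd ` set P)"
      moreover have "snd ` set P \<subseteq> range Proper" using P(1) by (auto simp: propers_def)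
      ultimately have "set v \<subseteq> insert trivial_letter (range Proper)" by blast
      then have "set v \<inter> virtuals m0 = {}" by (auto simp: virtuals_def)
      then show "act f (covector P) v = 0" by (rule Suc.prems(2))
    qed
    also have "act f (covector P) = (\<lambda>v. \<Sum>w\<in>Poly_Mapping.keys f. ?l w * word_act w (covector P) v)"
      by (rule ext) (rule act_def)
    also have "evaluate P \<dots> = (\<Sum>w\<in>Poly_Mapping.keys f. ?l w * pairing w P)"
      by (simp add: evaluate_sum evaluate_scale pairing_def)
    also have "\<dots> = (\<Sum>w\<in>Poly_Mapping.keys f. ?l w * of_bool (mset w = mset P)) * of_nat (multiplicities P)"
      unfolding sum_distrib_right
    proof (rule sum.cong[OF refl])
      fix w assume w: "w \<in> Poly_Mapping.keys f"
      have "length w \<le> length P" using w Suc.prems(1) P by (auto simp: short_def)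
      then have "pairing w P = of_bool (mset w = mset P) * of_nat (multiplicities P)"
        using PP[OF w] P PP_subset(2) by (intro pairing_eq) auto
      then show "?l w * pairing w P = ?l w * of_bool (mset w = mset P) * of_nat (multiplicities P)"
        by simp
    qed
    also have "(\<Sum>w\<in>Poly_Mapping.keys f. ?l w * of_bool (mset w = mset P)) = (\<Sum>w\<in>{w \<in> B. mset w = mset P}. ?l w)"
    proof (rule sum.mono_neutral_cong_right)
      have "length w = length P" if "mset w = mset P" for w using that by (rule mset_eq_length)
      then show "\<forall>w\<in>Poly_Mapping.keys f - {w \<in> B. mset w = mset P}. ?l w * of_bool (mset w = mset P) = 0"
        using P by (auto simp: B_def)
    qed (auto simp: B_def)
    finally show ?thesis using multiplicities_pos[of P] by simp
  qed
  \<comment> \<open>an arbitrary choice of one word in each class of rearrangements\<close>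
  define s where "s = (\<lambda>w :: (symbol \<times> symbol) list. SOME w'. mset w' = mset w)"
  have s: "mset (s w) = mset w" for w
    unfolding s_def by (rule someI[of _ w]) simp
  have s_eq: "s w = s w'" if "mset w = mset w'" for w w'
    using that by (simp add: s_def)
  have "(\<Sum>w\<in>B. Poly_Mapping.single (s w) (?l w)) = 0"
  proof (rule poly_mapping_eqI)
    fix y
    have "poly_mapping.lookup (\<Sum>w\<in>B. Poly_Mapping.single (s w) (?l w)) y = (\<Sum>w\<in>{w \<in> B. s w = y}. ?l w)"
      using fin by (simp add: lookup_sum lookup_single when_def sum.inter_filter)
    also have "\<dots> = 0"
    proof (cases "\<exists>P\<in>B. s P = y")
      case True
      then obtain P where P: "P \<in> B" "s P = y" by auto
      have "{w \<in> B. s w = y} = {w \<in> B. mset w = mset P}"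
        using P(2) s s_eq by (metis (no_types, lifting))
      then show ?thesis using orbit[OF P(1)] by simp
    next
      case False
      then have "{w \<in> B. s w = y} = {}" by auto
      then show ?thesis by (simp only: sum.empty)
    qed
    finally show "poly_mapping.lookup (\<Sum>w\<in>B. Poly_Mapping.single (s w) (?l w)) y = poly_mapping.lookup 0 y"
      by simp
  qed
  moreover have "f = (\<Sum>w\<in>B. Poly_Mapping.single w (?l w)) + (\<Sum>w\<in>C. Poly_Mapping.single w (?l w))"
    using free_expansion[of f] fin keys(2) by (simp add: keys(1) sum.union_disjoint)
  ultimately have "f = (\<Sum>w\<in>B. Poly_Mapping.single w (?l w) - Poly_Mapping.single (s w) (?l w))
      + (\<Sum>w\<in>C. Poly_Mapping.single w (?l w))"
    by (simp add: sum_subtractf)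
  also have "\<dots> \<in> reducible d"
  proof (rule reducible_add)
    show "(\<Sum>w\<in>B. Poly_Mapping.single w (?l w) - Poly_Mapping.single (s w) (?l w)) \<in> reducible d"
    proof (rule reducible_sum)
      fix w assume w: "w \<in> B"
      have "mon ([] @ w) - mon ([] @ s w) \<in> reducible d"
        using w PP[of w] s by (intro mon_permute) (auto simp: B_def)
      from reducible_scale[OF this, of "?l w"]
      show "Poly_Mapping.single w (?l w) - Poly_Mapping.single (s w) (?l w) \<in> reducible d"
        by (simp add: right_diff_distrib mult_single plus_list_def)
    qed
    show "(\<Sum>w\<in>C. Poly_Mapping.single w (?l w)) \<in> reducible d"
      using PP by (intro reducible_short short_sum short_single) (auto simp: C_def)
  qed
  finally obtain g where g: "g \<in> short d" "f - g \<in> env_ideal m0 n" by (auto simp: reducible_def)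
  have "act g \<phi> v = 0" if "set v \<inter> virtuals m0 = {}" for \<phi> v
    using Suc.prems(2)[OF that, of \<phi>] act_env_ideal[OF g(2), of \<phi> v] by (simp add: act_diff)
  then have "g \<in> env_ideal m0 n" by (rule Suc.IH[OF g(1)])
  from env_ideal_closed(2)[OF g(2) this] show ?case by simp
qed

lemma scalar_in_tensor: "Poly_Mapping.single [] c \<in> carrier (tensor_alg m0 n)"
  by (rule single_in_tensor) simp

lemma Ugl_proper_representative:
  assumes "u \<in> Ugl_proper m0 n"
  obtains f d where "f \<in> short d" "u = env_class m0 n f"
proof -
  have "\<exists>f. (\<forall>w\<in>Poly_Mapping.keys f. set w \<subseteq> PP) \<and> u = env_class m0 n f"
    using assms unfolding Ugl_proper_def
  proof induction
    case one
    show ?case by (intro exI[of _ 1]) (simp add: env_class_simps(4) zero_list_def)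
  next
    case (incl h)
    then show ?case
    proof
      assume "h \<in> range (scalar m0 n)"
      then obtain c where "h = env_class m0 n (Poly_Mapping.single [] c)" by (auto simp: scalar_def)
      then show ?thesis by (intro exI[of _ "Poly_Mapping.single [] c"]) auto
    next
      assume "h \<in> gen m0 n ` PP"
      then obtain a b where "(a, b) \<in> PP" "h = env_class m0 n (E a b)" by (auto simp: gen_def)
      then show ?thesis by (intro exI[of _ "E a b"]) (auto simp: E_def)
    qed
  next
    case (a_inv h)
    then obtain f where f: "\<forall>w\<in>Poly_Mapping.keys f. set w \<subseteq> PP" "h = env_class m0 n f" by auto
    then have "f \<in> carrier (tensor_alg m0 n)" by (simp only: keys_PP_in_tensor)
    then show ?case using f by (intro exI[of _ "- f"]) (auto simp: env_class_uminus in_keys_iff)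
  next
    case (eng_add h h')
    then obtain f g where f: "\<forall>w\<in>Poly_Mapping.keys f. set w \<subseteq> PP" "h = env_class m0 n f"
      and g: "\<forall>w\<in>Poly_Mapping.keys g. set w \<subseteq> PP" "h' = env_class m0 n g" by auto
    then have "f \<in> carrier (tensor_alg m0 n)" "g \<in> carrier (tensor_alg m0 n)"
      by (simp_all only: keys_PP_in_tensor)
    moreover have "\<forall>w\<in>Poly_Mapping.keys (f + g). set w \<subseteq> PP"
      using f g Poly_Mapping.keys_add[of f g] by auto
    ultimately show ?case using f g by (intro exI[of _ "f + g"]) (simp add: env_class_simps(2))
  next
    case (eng_mult h h')
    then obtain f g where f: "\<forall>w\<in>Poly_Mapping.keys f. set w \<subseteq> PP" "h = env_class m0 n f"
      and g: "\<forall>w\<in>Poly_Mapping.keys g. set w \<subseteq> PP" "h' = env_class m0 n g" by auto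
    then have "f \<in> carrier (tensor_alg m0 n)" "g \<in> carrier (tensor_alg m0 n)"
      by (simp_all only: keys_PP_in_tensor)
    moreover have "\<forall>w\<in>Poly_Mapping.keys (f * g). set w \<subseteq> PP"
    proof
      fix w assume "w \<in> Poly_Mapping.keys (f * g)"
      then obtain a b where "a \<in> Poly_Mapping.keys f" "b \<in> Poly_Mapping.keys g" "w = a + b"
        using keys_mult[of f g] by auto
      then show "set w \<subseteq> PP" using f g by (auto simp: plus_list_def)
    qed
    ultimately show ?case using f g by (intro exI[of _ "f * g"]) (simp add: env_class_simps(3))
  qed
  then obtain f where f: "\<forall>w\<in>Poly_Mapping.keys f. set w \<subseteq> PP" "u = env_class m0 n f" by auto
  have "f \<in> short (Suc (Max (length ` Poly_Mapping.keys f)))"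
    using f by (auto simp: short_def less_Suc_eq_le)
  then show thesis using that f by blast
qed

lemma Ugl_proper_Irr_disjoint:
  assumes "u \<in> Ugl_proper m0 n" "u \<in> Irr m0 n"
  shows "u = \<zero>\<^bsub>Ugl m0 n\<^esub>"
proof -
  obtain f d where f: "f \<in> short d" "u = env_class m0 n f"
    using Ugl_proper_representative[OF assms(1)] .
  have fT: "f \<in> carrier (tensor_alg m0 n)" using f(1) by (rule short_in_tensor)
  have "f \<in> env_ideal m0 n"
    using assms(2) f fT by (intro faithful act_Irr) auto
  then show ?thesis using fT by (simp add: f(2) env_class_eq_iff tensor_closed flip: env_class_zero)
qed

lemma Ugl_proper_subset: "Ugl_proper m0 n \<subseteq> carrier (Ugl m0 n)"
proof
  fix u assume "u \<in> Ugl_proper m0 n"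
  then obtain f d where "f \<in> short d" "u = env_class m0 n f" by (rule Ugl_proper_representative)
  then show "u \<in> carrier (Ugl m0 n)" by (simp add: env_class_simps short_in_tensor)
qed

text \<open>
  The definite description in \<open>devirt\<close> has at most one solution, because two of them differ by an
  element of \<open>\<^bold>U(gl(n)) \<inter> \<^bold>I\<^bold>r\<^bold>r\<close>.
\<close>

lemma devirt_eqI:
  assumes "x \<in> carrier (Ugl m0 n)" "u \<in> Ugl_proper m0 n" "x \<ominus>\<^bsub>Ugl m0 n\<^esub> u \<in> Irr m0 n"
  shows "devirt m0 n x = u"
  unfolding devirt_def
proof (rule the_equality)
  interpret U: ring "Ugl m0 n" by (rule Ugl_ring)
  interpret Irr: additive_subgroup "Irr m0 n" "Ugl m0 n"
    using left_ideal_Irr by (simp add: left_ideal_def)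
  fix u' assume u': "u' \<in> Ugl_proper m0 n \<and> x \<ominus>\<^bsub>Ugl m0 n\<^esub> u' \<in> Irr m0 n"
  have c: "u \<in> carrier (Ugl m0 n)" "u' \<in> carrier (Ugl m0 n)"
    using assms(2) u' Ugl_proper_subset by auto
  have "(x \<ominus>\<^bsub>Ugl m0 n\<^esub> u) \<oplus>\<^bsub>Ugl m0 n\<^esub> \<ominus>\<^bsub>Ugl m0 n\<^esub> (x \<ominus>\<^bsub>Ugl m0 n\<^esub> u') \<in> Irr m0 n"
    using assms(3) u' by (intro Irr.a_closed Irr.a_inv_closed) auto
  also have "(x \<ominus>\<^bsub>Ugl m0 n\<^esub> u) \<oplus>\<^bsub>Ugl m0 n\<^esub> \<ominus>\<^bsub>Ugl m0 n\<^esub> (x \<ominus>\<^bsub>Ugl m0 n\<^esub> u') = u' \<oplus>\<^bsub>Ugl m0 n\<^esub> \<ominus>\<^bsub>Ugl m0 n\<^esub> u"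
    using assms(1) c by algebra
  finally have "u' \<oplus>\<^bsub>Ugl m0 n\<^esub> \<ominus>\<^bsub>Ugl m0 n\<^esub> u = \<zero>\<^bsub>Ugl m0 n\<^esub>"
    using assms(2) u' unfolding Ugl_proper_def
    by (intro Ugl_proper_Irr_disjoint[unfolded Ugl_proper_def]) (auto intro: generate_ring.intros)
  then show "u' = u" using c by (metis U.minus_equality U.minus_minus U.a_inv_closed)
qed (use assms in simp)

end

section \<open>The product of all enveloping algebras as a type\<close>

text \<open>
  The one-element ring is not an instance of \<open>ring_1\<close>, so that the unit must not be zero in the quotient.
\<close>

lemma one_notin_env_ideal: "1 \<notin> env_ideal m0 n"
proof
  assume "1 \<in> env_ideal m0 n"
  then have "act 1 (\<lambda>_. 1) [] = 0" by (rule act_env_ideal)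
  moreover have one: "Poly_Mapping.single [] 1 = (1 :: free_elt)" by (metis single_one zero_list_def)
  have "act 1 (\<lambda>_. 1) [] = 1"
    using act_single[of "[]" 1 "\<lambda>_. 1" "[]"] unfolding one by simp
  ultimately show False by simp
qed

text \<open>
  A type cannot depend on \<open>m\<^sub>0\<close> and \<open>n\<close>. The product over all values of these parameters is a single type, and
  its component at \<open>(m\<^sub>0, n)\<close> is a ring homomorphism onto \<open>\<^bold>U(gl(m\<^sub>0|n))\<close> through which identities
  descend.
\<close>

typedef ugl_family = "{F :: nat \<times> nat \<Rightarrow> free_elt set. \<forall>m0 n. F (m0, n) \<in> carrier (Ugl m0 n)}"
proof -
  have "\<zero>\<^bsub>Ugl m0 n\<^esub> \<in> carrier (Ugl m0 n)" for m0 n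
    by (rule ring.ring_simprules(2)[OF Ugl_ring])
  then show ?thesis by (intro exI[of _ "\<lambda>(m0, n). \<zero>\<^bsub>Ugl m0 n\<^esub>"]) auto
qed

definition component :: "nat \<Rightarrow> nat \<Rightarrow> ugl_family \<Rightarrow> free_elt set" where
  "component m0 n x = Rep_ugl_family x (m0, n)"

definition family :: "(nat \<Rightarrow> nat \<Rightarrow> free_elt set) \<Rightarrow> ugl_family" where
  "family F = Abs_ugl_family (\<lambda>(m0, n). F m0 n)"

lemma component_closed [simp]: "component m0 n x \<in> carrier (Ugl m0 n)"
  using Rep_ugl_family[of x] by (simp add: component_def)

lemma component_family:
  "(\<And>m0 n. F m0 n \<in> carrier (Ugl m0 n)) \<Longrightarrow> component m0 n (family F) = F m0 n"
  by (simp add: component_def family_def Abs_ugl_family_inverse)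

lemma ugl_family_eqI: "(\<And>m0 n. component m0 n x = component m0 n y) \<Longrightarrow> x = y"
  by (auto simp: component_def Rep_ugl_family_inject[symmetric])

instantiation ugl_family :: ring_1
begin

definition "0 = family (\<lambda>m0 n. \<zero>\<^bsub>Ugl m0 n\<^esub>)"

definition "1 = family (\<lambda>m0 n. \<one>\<^bsub>Ugl m0 n\<^esub>)"

definition "x + y = family (\<lambda>m0 n. component m0 n x \<oplus>\<^bsub>Ugl m0 n\<^esub> component m0 n y)"

definition "- x = family (\<lambda>m0 n. \<ominus>\<^bsub>Ugl m0 n\<^esub> component m0 n x)"

definition "x - y = family (\<lambda>m0 n. component m0 n x \<ominus>\<^bsub>Ugl m0 n\<^esub> component m0 n y)"

definition "x * y = family (\<lambda>m0 n. component m0 n x \<otimes>\<^bsub>Ugl m0 n\<^esub> component m0 n y)"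

lemma component_simps [simp]:
  "component m0 n 0 = \<zero>\<^bsub>Ugl m0 n\<^esub>"
  "component m0 n 1 = \<one>\<^bsub>Ugl m0 n\<^esub>"
  "component m0 n (x + y) = component m0 n x \<oplus>\<^bsub>Ugl m0 n\<^esub> component m0 n y"
  "component m0 n (- x) = \<ominus>\<^bsub>Ugl m0 n\<^esub> component m0 n x"
  "component m0 n (x - y) = component m0 n x \<ominus>\<^bsub>Ugl m0 n\<^esub> component m0 n y"
  "component m0 n (x * y) = component m0 n x \<otimes>\<^bsub>Ugl m0 n\<^esub> component m0 n y"
  unfolding zero_ugl_family_def one_ugl_family_def plus_ugl_family_def uminus_ugl_family_def
    minus_ugl_family_def times_ugl_family_def
  by (subst component_family, simp_all add: ring.ring_simprules[OF Ugl_ring])+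

instance
proof
  fix a b c :: ugl_family
  note R = Ugl_ring
  show "a + b + c = a + (b + c)"
    by (rule ugl_family_eqI) (simp add: ring.ring_simprules[OF R])
  show "a + b = b + a"
    by (rule ugl_family_eqI) (simp add: ring.ring_simprules[OF R])
  show "0 + a = a"
    by (rule ugl_family_eqI) (simp add: ring.ring_simprules[OF R])
  show "- a + a = 0"
    by (rule ugl_family_eqI) (simp add: ring.ring_simprules[OF R])
  show "a - b = a + - b"
    by (rule ugl_family_eqI) (simp add: a_minus_def)
  show "a * b * c = a * (b * c)"
    by (rule ugl_family_eqI) (simp add: ring.ring_simprules[OF R])
  show "(a + b) * c = a * c + b * c"
    by (rule ugl_family_eqI) (simp add: ring.ring_simprules[OF R])
  show "a * (b + c) = a * b + a * c"
    by (rule ugl_family_eqI) (simp add: ring.ring_simprules[OF R])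
  show "1 * a = a" "a * 1 = a"
    by (rule ugl_family_eqI, simp add: ring.ring_simprules[OF R] ring.is_monoid[OF R] monoid.r_one)+
  show "(0::ugl_family) \<noteq> 1"
  proof
    assume "(0::ugl_family) = 1"
    then have "component 0 0 0 = component 0 0 1" by simp
    then have "env_class 0 0 1 = env_class 0 0 0"
      by (simp add: env_class_zero env_class_simps)
    then show False using one_notin_env_ideal by (simp add: env_class_eq_iff tensor_closed)
  qed
qed

end

lemma component_sum:
  assumes "finite B"
  shows "component m0 n (sum f B) = (\<Oplus>\<^bsub>Ugl m0 n\<^esub>i\<in>B. component m0 n (f i))"
proof -
  interpret U: ring "Ugl m0 n" by (rule Ugl_ring)
  show ?thesis using assms by induction simp_all
qed

definition scalars :: "complex \<Rightarrow> ugl_family" where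
  "scalars c = family (\<lambda>m0 n. scalar m0 n c)"

lemma component_scalars: "component m0 n (scalars c) = scalar m0 n c"
  by (simp add: scalars_def component_family scalar_def env_class_simps scalar_in_tensor)

lemma component_representative:
  obtains f where "f \<in> carrier (tensor_alg m0 n)" "component m0 n x = env_class m0 n f"
  using component_closed[of m0 n x] by (auto simp: carrier_Ugl)

lemma single_Nil_commute: "Poly_Mapping.single [] c * f = f * (Poly_Mapping.single [] c :: free_elt)"
proof (induction f rule: free_induct)
  case (single w d)
  then show ?case by (simp add: mult_single plus_list_def mult.commute)
qed (simp_all add: algebra_simps)

lemma scalars_commute: "scalars c * x = x * scalars c"
proof (rule ugl_family_eqI)
  fix m0 n
  obtain f where "f \<in> carrier (tensor_alg m0 n)" "component m0 n x = env_class m0 n f"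
    by (rule component_representative)
  then show "component m0 n (scalars c * x) = component m0 n (x * scalars c)"
    by (simp add: component_scalars scalar_def scalar_in_tensor single_Nil_commute flip: env_class_simps(3))
qed

lemma scalars_add: "scalars (c + d) = scalars c + scalars d"
  by (rule ugl_family_eqI)
    (simp add: component_scalars scalar_def scalar_in_tensor single_add flip: env_class_simps(2))

lemma scalars_one: "scalars 1 = 1"
proof (rule ugl_family_eqI)
  fix m0 n
  have "Poly_Mapping.single [] 1 = (1 :: free_elt)" by (metis single_one zero_list_def)
  then show "component m0 n (scalars 1) = component m0 n 1"
    by (simp add: component_scalars scalar_def env_class_simps(4))
qed

lemma scalars_zero: "scalars 0 = 0"
  using scalars_add[of 0 0] by simp

lemma scalars_uminus: "scalars (- c) = - scalars c"
  using scalars_add[of c "- c"] by (simp add: scalars_zero eq_neg_iff_add_eq_0 add.commute)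

lemma scalars_of_nat: "scalars (of_nat k) = of_nat k"
  by (induction k) (simp_all add: scalars_zero scalars_one scalars_add)

lemma scalars_of_int: "scalars (of_int k) = of_int k"
  by (cases k rule: int_cases2) (simp_all add: scalars_of_nat scalars_uminus)

lemma ugl_family_double_zero:
  assumes "x + x = (0 :: ugl_family)"
  shows "x = 0"
proof -
  have "x = scalars (1/2 + 1/2) * x" by (simp add: scalars_one)
  also have "\<dots> = scalars (1/2) * (x + x)" by (simp only: scalars_add distrib_left distrib_right)
  finally show ?thesis using assms by simp
qed

text \<open>
  The relations of \<open>gl(m\<^sub>0|n)\<close> have to hold in every component of the product. Elements whose other
  components vanish satisfy them there trivially.
\<close>

definition concentrated :: "nat \<Rightarrow> nat \<Rightarrow> free_elt \<Rightarrow> ugl_family" where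
  "concentrated m0 n f
    = family (\<lambda>m0' n'. if m0' = m0 \<and> n' = n then env_class m0 n f else \<zero>\<^bsub>Ugl m0' n'\<^esub>)"

lemma component_concentrated:
  assumes "f \<in> carrier (tensor_alg m0 n)"
  shows "component m0' n' (concentrated m0 n f)
    = (if m0' = m0 \<and> n' = n then env_class m0 n f else \<zero>\<^bsub>Ugl m0' n'\<^esub>)"
  unfolding concentrated_def
  by (rule component_family) (simp add: assms env_class_simps ring.ring_simprules(2)[OF Ugl_ring])

lemma concentrated_simps:
  assumes "f \<in> carrier (tensor_alg m0 n)" "g \<in> carrier (tensor_alg m0 n)"
  shows "concentrated m0 n f + concentrated m0 n g = concentrated m0 n (f + g)"
    "concentrated m0 n f - concentrated m0 n g = concentrated m0 n (f - g)"
    "concentrated m0 n f * concentrated m0 n g = concentrated m0 n (f * g)"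
proof -
  show "concentrated m0 n f + concentrated m0 n g = concentrated m0 n (f + g)"
    by (rule ugl_family_eqI)
      (simp add: component_concentrated assms tensor_closed env_class_simps(2) ring.ring_simprules[OF Ugl_ring])
  show "concentrated m0 n f - concentrated m0 n g = concentrated m0 n (f - g)"
    by (rule ugl_family_eqI)
      (simp add: component_concentrated assms tensor_diff env_class_diff a_minus_def ring.ring_simprules[OF Ugl_ring]
        ring.minus_zero[OF Ugl_ring])
  have null: "\<zero>\<^bsub>Ugl m0 n\<^esub> \<otimes>\<^bsub>Ugl m0 n\<^esub> \<zero>\<^bsub>Ugl m0 n\<^esub> = \<zero>\<^bsub>Ugl m0 n\<^esub>" for m0 n
  proof -
    interpret ring "Ugl m0 n" by (rule Ugl_ring)
    show ?thesis by simp
  qed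
  show "concentrated m0 n f * concentrated m0 n g = concentrated m0 n (f * g)"
    by (rule ugl_family_eqI)
      (simp add: component_concentrated assms tensor_closed env_class_simps(3) null)
qed

lemma concentrated_sign:
  assumes "f \<in> carrier (tensor_alg m0 n)"
  shows "(-1) ^ k * concentrated m0 n f = concentrated m0 n ((-1) ^ k * f)"
proof -
  have "- concentrated m0 n f = concentrated m0 n (- f)"
    by (rule ugl_family_eqI)
      (simp add: component_concentrated assms tensor_closed env_class_uminus ring.minus_zero[OF Ugl_ring])
  then show "(-1) ^ k * concentrated m0 n f = concentrated m0 n ((-1) ^ k * f)"
    by (cases "even k") simp_all
qed

definition generator :: "nat \<Rightarrow> nat \<Rightarrow> symbol \<Rightarrow> symbol \<Rightarrow> ugl_family" where
  "generator m0 n a b = concentrated m0 n (E a b)"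

lemma component_generator:
  "a \<in> symbols m0 n \<Longrightarrow> b \<in> symbols m0 n \<Longrightarrow> component m0 n (generator m0 n a b) = gen m0 n (a, b)"
  by (simp add: generator_def component_concentrated E_in_tensor gen_def)

lemma generator_relation:
  assumes "{a, b, c, d} \<subseteq> symbols m0 n"
  shows "generator m0 n a b * generator m0 n c d
    = (-1) ^ ((parity a + parity b) * (parity c + parity d)) * (generator m0 n c d * generator m0 n a b)
      + ((if b = c then generator m0 n a d else 0)
         - (-1) ^ ((parity a + parity b) * (parity c + parity d)) * (if a = d then generator m0 n c b else 0))"
proof -
  let ?s = "(-1) ^ ((parity a + parity b) * (parity c + parity d))"
  have zero: "concentrated m0 n 0 = 0"
    by (rule ugl_family_eqI) (simp add: component_concentrated tensor_closed env_class_zero)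
  have E: "E x y \<in> carrier (tensor_alg m0 n)" if "x \<in> {a, b, c, d}" "y \<in> {a, b, c, d}" for x y
    using that assms by (auto intro: E_in_tensor)
  have eq: "concentrated m0 n f = concentrated m0 n g"
    if "f \<in> carrier (tensor_alg m0 n)" "g \<in> carrier (tensor_alg m0 n)" "f - g \<in> env_ideal m0 n" for f g
    using that by (intro ugl_family_eqI) (simp add: component_concentrated env_class_eq_iff)
  define X where "X = (if b = c then E a d else 0)"
  define Y where "Y = (if a = d then E c b else 0)"
  have X: "X \<in> carrier (tensor_alg m0 n)" "(if b = c then generator m0 n a d else 0) = concentrated m0 n X"
    and Y: "Y \<in> carrier (tensor_alg m0 n)" "(if a = d then generator m0 n c b else 0) = concentrated m0 n Y"
    using E by (auto simp: X_def Y_def generator_def zero tensor_closed)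
  have sY: "?s * Y \<in> carrier (tensor_alg m0 n)" and sE: "?s * (E c d * E a b) \<in> carrier (tensor_alg m0 n)"
    using Y(1) E by (auto intro!: tensor_closed(2) sign_in_tensor)
  have "generator m0 n a b * generator m0 n c d = concentrated m0 n (E a b * E c d)"
    by (simp add: generator_def concentrated_simps E)
  also have "\<dots> = concentrated m0 n (?s * (E c d * E a b) + (X - ?s * Y))"
  proof (rule eq)
    show "E a b * E c d - (?s * (E c d * E a b) + (X - ?s * Y)) \<in> env_ideal m0 n"
      using env_ideal_relation[OF assms] by (simp add: superbracket_def X_def Y_def diff_diff_eq)
  qed (intro tensor_closed(1,2) tensor_diff X(1) sY sE E; simp)+
  also have "\<dots> = ?s * (concentrated m0 n (E c d) * concentrated m0 n (E a b))
      + (concentrated m0 n X - ?s * concentrated m0 n Y)"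
    by (simp add: concentrated_simps concentrated_sign E X(1) Y(1) sY sE tensor_closed(2) tensor_diff)
  finally show ?thesis unfolding X(2) Y(2) by (simp only: generator_def)
qed

lemma component_word:
  "set w \<subseteq> symbols m0 n \<times> symbols m0 n \<Longrightarrow>
    component m0 n (prod_list (map (case_prod (generator m0 n)) w)) = gen_prod m0 n w"
  by (induction w) (auto simp: gen_prod_def component_generator)

section \<open>The expansion of the enlarged Capelli-Deruyts bitableau\<close>

context
  fixes m0 n :: nat
begin

interpretation gl_algebra m0 n "generator m0 n" "range scalars" "{x. component m0 n x \<in> Irr m0 n}"
proof
  interpret Irr: additive_subgroup "Irr m0 n" "Ugl m0 n"
    using left_ideal_Irr by (simp add: left_ideal_def)
  show "0 \<in> {x. component m0 n x \<in> Irr m0 n}" using Irr.zero_closed by simp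
  show "x + y \<in> {x. component m0 n x \<in> Irr m0 n}"
    if "x \<in> {x. component m0 n x \<in> Irr m0 n}" "y \<in> {x. component m0 n x \<in> Irr m0 n}" for x y
    using that Irr.a_closed by simp
  show "x * y \<in> {x. component m0 n x \<in> Irr m0 n}" if "y \<in> {x. component m0 n x \<in> Irr m0 n}" for x y
    using that left_ideal_Irr by (simp add: left_ideal_def)
  show "prod_list (map (case_prod (generator m0 n)) w) \<in> {x. component m0 n x \<in> Irr m0 n}"
    if "set w \<subseteq> symbols m0 n \<times> symbols m0 n" "irregular m0 w" for w
    using that by (simp add: component_word irregular_in_Irr)
  show "x = 0" if "x + x = 0" for x :: ugl_family
    using that by (rule ugl_family_double_zero)
  show "k * x = x * k" if "k \<in> range scalars" for k x
    using that scalars_commute by blast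
qed (rule generator_relation)

lemma component_proper_alg: "x \<in> proper_alg \<Longrightarrow> component m0 n x \<in> Ugl_proper m0 n"
proof (induction rule: proper_alg.induct)
  case proper_alg_one
  then show ?case by (simp add: Ugl_proper_def generate_ring.one)
next
  case (proper_alg_central k)
  then show ?case by (auto simp: Ugl_proper_def component_scalars intro: generate_ring.incl)
next
  case (proper_alg_gen i j)
  then have "component m0 n (generator m0 n (Proper i) (Proper j)) = gen m0 n (Proper i, Proper j)"
    by (intro component_generator) (auto simp: symbols_def propers_def)
  then show ?case using proper_alg_gen by (auto simp: Ugl_proper_def propers_def intro!: generate_ring.incl)
qed (simp_all add: Ugl_proper_def generate_ring.intros)

lemma capelli_bitableau_eqI:
  assumes "set (cells S) \<subseteq> {1..m0} \<times> {1..n}" "set (cells T) \<subseteq> {1..m0} \<times> {1..n}"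
    and "u \<in> proper_alg" "component m0 n (annihilation_word (cells S) * creation_word (cells T) - u) \<in> Irr m0 n"
  shows "capelli_bitableau m0 n S T = component m0 n u"
proof -
  have "set (left_word S @ right_word T) \<subseteq> symbols m0 n \<times> symbols m0 n"
    using assms(1,2) by (fastforce simp: left_word_cells right_word_cells)
  then have "gen_prod m0 n (left_word S @ right_word T)
      = component m0 n (prod_list (map (case_prod (generator m0 n)) (left_word S @ right_word T)))"
    by (simp only: component_word)
  also have "prod_list (map (case_prod (generator m0 n)) (left_word S @ right_word T)) = annihilation_word (cells S) * creation_word (cells T)"
    by (simp add: left_word_cells right_word_cells annihilation_word_def creation_word_def comp_def split_def)
  finally have eq: "gen_prod m0 n (left_word S @ right_word T)
      = component m0 n (annihilation_word (cells S) * creation_word (cells T))" .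
  show ?thesis
    unfolding capelli_bitableau_def eq
    by (rule devirt_eqI[OF component_closed component_proper_alg[OF assms(3)]]) (use assms(4) in simp)
qed

lemma falling_factorial_ffact: "falling_factorial p j = of_int (ffact p j)"
  by (simp add: falling_factorial_def ffact_def)

lemma cells_deruyts:
  assumes "\<forall>l\<in>set lam. l \<le> n" "length lam \<le> m"
  shows "set (cells (deruyts_left lam)) \<subseteq> {1..m} \<times> {1..n}"
    and "set (cells (deruyts_right lam)) \<subseteq> {1..m} \<times> {1..n}"
  using assms
  by (induction lam rule: rev_induct) (auto simp: deruyts_left_def deruyts_right_def cells_snoc)

text \<open>
  All bitableaux are identified through \<open>capelli_bitableau_eqI\<close>: a one-row bitableau with a minor without shift,
  \<open>\<^bold>K\<^sup>\<lambda>\<close> with some \<open>u\<close>, and the enlarged one with a minor shifted by \<open>-p\<close> times \<open>u\<close>.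
  Then the shifted minor is expanded, and the subsets \<open>J\<close> are sorted by their cardinality.
\<close>

lemma capelli_deruyts_row_expansion:
  assumes "lam \<noteq> []" "\<forall>l\<in>set lam. l \<le> n \<and> k \<le> l" "M \<subseteq> {1..k}" "m0 \<ge> length lam + 1"
  shows "scalar m0 n ((-1) ^ (sum_list lam * card M)) \<otimes>\<^bsub>Ugl m0 n\<^esub> capelli_deruyts_row m0 n lam M =
    (\<Oplus>\<^bsub>Ugl m0 n\<^esub> k \<in> {0..card M}.
       scalar m0 n ((-1) ^ (card M - k) * falling_factorial (length lam) (card M - k)) \<otimes>\<^bsub>Ugl m0 n\<^esub>
       (\<Oplus>\<^bsub>Ugl m0 n\<^esub> J \<in> {J. J \<subseteq> M \<and> card J = k}.
          row_bitableau m0 n J \<otimes>\<^bsub>Ugl m0 n\<^esub> capelli_deruyts m0 n lam))"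
proof -
  interpret U: ring "Ugl m0 n" by (rule Ugl_ring)
  let ?p = "length lam"
  let ?e = "\<lambda>i j. generator m0 n (Proper i) (Proper j)"
  define xs where "xs = cells (deruyts_left lam)"
  define ys where "ys = cells (deruyts_right lam)"
  have k: "k \<le> n" using assms(1,2) by (cases lam) auto
  have M: "finite M" "M \<subseteq> {1..n}" using assms(3) k finite_subset by (blast, auto)
  have xs: "set xs \<subseteq> {1..m0} \<times> {1..n}" and ys: "set ys \<subseteq> {1..m0} \<times> {1..n}"
    using cells_deruyts[of lam m0] assms(2,4) by (simp_all add: xs_def ys_def)
  have len: "length xs = length ys"
    by (simp add: xs_def ys_def length_cells deruyts_left_def deruyts_right_def comp_def)
  obtain u where u: "u \<in> proper_alg" "component m0 n (annihilation_word xs * creation_word ys - u) \<in> Irr m0 n"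
    using balanced_in_Virt[OF len xs ys] by blast
  have K: "capelli_deruyts m0 n lam = component m0 n u"
    unfolding capelli_deruyts_def using xs ys u by (intro capelli_bitableau_eqI) (simp_all add: xs_def ys_def)
  have row: "row_bitableau m0 n J = component m0 n (pminor ?e 0 J)" if "J \<subseteq> M" for J
  proof -
    have J: "J \<subseteq> {1..n}" "finite J" using that M finite_subset by auto
    have "set (cells [rev (sorted_list_of_set J)]) \<subseteq> {1..m0} \<times> {1..n}"
      "set (cells [sorted_list_of_set J]) \<subseteq> {1..m0} \<times> {1..n}"
      using J assms(4) by (auto simp: cells_snoc[of "[]", simplified])
    then show ?thesis
      unfolding row_bitableau_def
      using row_mod_Z[OF J(1)] assms(4) pminor_in_proper_alg[OF J(1)]
      by (intro capelli_bitableau_eqI) simp_all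
  qed
  let ?N = "sum_list lam * card M"
  let ?P = "pminor ?e (- int ?p) M"
  have "capelli_deruyts_row m0 n lam M = component m0 n ((-1) ^ ?N * (?P * u))"
    unfolding capelli_deruyts_row_def
  proof (rule capelli_bitableau_eqI)
    show "set (cells (deruyts_left lam @ [rev (sorted_list_of_set M)])) \<subseteq> {1..m0} \<times> {1..n}"
      using xs M assms(4) by (auto simp: cells_snoc xs_def deruyts_left_def)
    show "set (cells (deruyts_right lam @ [sorted_list_of_set M])) \<subseteq> {1..m0} \<times> {1..n}"
      using ys M assms(4) by (auto simp: cells_snoc ys_def deruyts_right_def)
    have "(-1) ^ ?N \<in> proper_alg" using proper_alg_of_int[of "(-1) ^ ?N"] by simp
    then show "(-1) ^ ?N * (?P * u) \<in> proper_alg"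
      using u pminor_in_proper_alg[OF M(2)] by (intro proper_alg_mult)
    have "component m0 n (- (annihilation_word xs * creation_word ys - u)) \<in> Irr m0 n"
      using u(2) Z_uminus by blast
    then have "u - annihilation_word xs * creation_word ys \<in> {x. component m0 n x \<in> Irr m0 n}" by (simp del: component_simps)
    from deruyts_row_mod_Z[OF assms this[unfolded xs_def ys_def]]
    show "component m0 n (annihilation_word (cells (deruyts_left lam @ [rev (sorted_list_of_set M)])) *
        creation_word (cells (deruyts_right lam @ [sorted_list_of_set M])) - (-1) ^ ?N * (?P * u)) \<in> Irr m0 n"
      by (simp del: component_simps)
  qed
  moreover have "scalar m0 n ((-1) ^ ?N) = component m0 n ((-1) ^ ?N)"
    using scalars_of_int[of "(-1) ^ ?N"] by (simp flip: component_scalars)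
  ultimately have "scalar m0 n ((-1) ^ ?N) \<otimes>\<^bsub>Ugl m0 n\<^esub> capelli_deruyts_row m0 n lam M
      = component m0 n ((-1) ^ ?N * ((-1) ^ ?N * (?P * u)))"
    by (simp del: mult_minus1)
  also have "(-1) ^ ?N * ((-1) ^ ?N * (?P * u)) = ?P * u"
    by (cases "even ?N") simp_all
  finally have lhs: "scalar m0 n ((-1) ^ ?N) \<otimes>\<^bsub>Ugl m0 n\<^esub> capelli_deruyts_row m0 n lam M = component m0 n (?P * u)" .
  let ?co = "\<lambda>d. (-1) ^ d * ffact ?p d :: int"
  have sc: "scalar m0 n ((-1) ^ d * falling_factorial ?p d) = component m0 n (of_int (?co d))" for d
    using scalars_of_int[of "?co d"] by (simp add: falling_factorial_ffact flip: component_scalars)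
  have fin: "finite {J. J \<subseteq> M \<and> card J = k}" for k
    using M(1) by simp
  have "?P * u = (\<Sum>J\<in>Pow M. of_int (?co (card M - card J)) * (pminor ?e 0 J * u))"
    unfolding pminor_neg_shift[OF M(1)] sum_distrib_right by (simp add: mult.assoc)
  also have "\<dots> = (\<Sum>k\<in>{0..card M}. \<Sum>J\<in>{J \<in> Pow M. card J = k}. of_int (?co (card M - card J)) * (pminor ?e 0 J * u))"
    using M(1) by (intro sum.group[symmetric]) (auto intro: card_mono)
  also have "\<dots> = (\<Sum>k\<in>{0..card M}. of_int (?co (card M - k)) * (\<Sum>J\<in>{J. J \<subseteq> M \<and> card J = k}. pminor ?e 0 J * u))"
    unfolding sum_distrib_left by (intro sum.cong) auto
  finally have "component m0 n (?P * u) = (\<Oplus>\<^bsub>Ugl m0 n\<^esub> k \<in> {0..card M}.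
       scalar m0 n ((-1) ^ (card M - k) * falling_factorial ?p (card M - k)) \<otimes>\<^bsub>Ugl m0 n\<^esub>
       (\<Oplus>\<^bsub>Ugl m0 n\<^esub> J \<in> {J. J \<subseteq> M \<and> card J = k}. component m0 n (pminor ?e 0 J * u)))"
    by (simp only: component_sum finite_atLeastAtMost fin component_simps(6) sc)
  also have "\<dots> = (\<Oplus>\<^bsub>Ugl m0 n\<^esub> k \<in> {0..card M}.
       scalar m0 n ((-1) ^ (card M - k) * falling_factorial ?p (card M - k)) \<otimes>\<^bsub>Ugl m0 n\<^esub>
       (\<Oplus>\<^bsub>Ugl m0 n\<^esub> J \<in> {J. J \<subseteq> M \<and> card J = k}.
          row_bitableau m0 n J \<otimes>\<^bsub>Ugl m0 n\<^esub> capelli_deruyts m0 n lam))"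
  proof -
    have "(\<Oplus>\<^bsub>Ugl m0 n\<^esub> J \<in> {J. J \<subseteq> M \<and> card J = k}. component m0 n (pminor ?e 0 J * u))
        = (\<Oplus>\<^bsub>Ugl m0 n\<^esub> J \<in> {J. J \<subseteq> M \<and> card J = k}.
          row_bitableau m0 n J \<otimes>\<^bsub>Ugl m0 n\<^esub> capelli_deruyts m0 n lam)" for k
      by (rule U.finsum_cong') (auto simp: row K)
    then show ?thesis by simp
  qed
  finally show ?thesis using lhs by simp
qed

end

theorem theorem3:
  fixes n m0 m :: nat and lam :: "nat list" and M :: "nat set"
  assumes "n \<ge> 1"
    and "lam \<noteq> []"
    and "sorted_wrt (\<ge>) lam"
    and "\<forall>l \<in> set lam. l > 0"
    and "hd lam \<le> n"
    and "m \<le> last lam"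
    and "M \<subseteq> {1..last lam}"
    and "card M = m"
    and "m0 \<ge> length lam + 1"
  shows "scalar m0 n ((-1) ^ (sum_list lam * m)) \<otimes>\<^bsub>Ugl m0 n\<^esub> capelli_deruyts_row m0 n lam M =
    (\<Oplus>\<^bsub>Ugl m0 n\<^esub> k \<in> {0..m}.
       scalar m0 n ((-1) ^ (m - k) * falling_factorial (length lam) (m - k)) \<otimes>\<^bsub>Ugl m0 n\<^esub>
       (\<Oplus>\<^bsub>Ugl m0 n\<^esub> J \<in> {J. J \<subseteq> M \<and> card J = k}.
          row_bitableau m0 n J \<otimes>\<^bsub>Ugl m0 n\<^esub> capelli_deruyts m0 n lam))"
proof -
  have "l \<le> n" if "l \<in> set lam" for l
    using assms(2,3,5) that by (cases lam) auto
  moreover have "last lam \<le> l" if "l \<in> set lam" for l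
    using assms(2,3) that by (cases lam rule: rev_cases) (auto simp: sorted_wrt_append)
  ultimately have "\<forall>l\<in>set lam. l \<le> n \<and> last lam \<le> l" by blast
  from capelli_deruyts_row_expansion[OF assms(2) this assms(7,9)]
  show ?thesis unfolding assms(8) .
qed

end
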